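(* Let $f$ be an analytic diffeomorphism of a neighborhood of the origin in $\mathbb{C}^n$ with $f(0)=0$, and let $\mu=(\mu_1,\ldots,\mu_n)$ be the eigenvalues of the Jacobian matrix $\mathrm{D}f(0)$. Then the number of functionally independent meromorphic first integrals of $f$ in $(\mathbb{C}^n,0)$ is at most the dimension (that is, the rank) of the $\mathbb{Z}$-linear space generated by the set $\{\mathbf{k}\in\mathbb{Z}^n:\ \mu^{\mathbf{k}}=1\}$.
   Context: $(\mathbb{C}^n,0)$ denotes a (sufficiently small, connected) neighborhood of the origin in $\mathbb{C}^n$. "Analytic diffeomorphism" means that $f$ is analytic and $\mathrm{D}f(0)$ is invertible, so $\mu_1\mu_2\cdots\mu_n\neq 0$. The eigenvalues are listed with algebraic multiplicity. For $\mathbf{k}=(k_1,\ldots,k_n)\in\mathbb{Z}^n$, $\mu^{\mathbf{k}}=\mu_1^{k_1}\cdots\mu_n^{k_n}$. A meromorphic first integral of $f$ in $(\mathbb{C}^n,0)$ is a function $R=G/H$, with $G,H$ analytic in $(\mathbb{C}^n,0)$ and $H\not\equiv 0$, such that $G(f(x))H(x)=G(x)H(f(x))$ for all $x\in(\mathbb{C}^n,0)$; equivalently $R(f(x))=R(x)$ wherever both sides are defined. Meromorphic functions $R_1,\ldots,R_m$ in $(\mathbb{C}^n,0)$ are functionally independent if their gradients are linearly independent at the points of an open dense subset of the neighborhood (equivalently, $dR_1\wedge\cdots\wedge dR_m\not\equiv 0$). *)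

theory Defs
  imports "HOL-Analysis.Analysis" "HOL-Computational_Algebra.Polynomial"
begin

definition mv_analytic_on :: "(complex ^ 'n \<Rightarrow> complex) \<Rightarrow> (complex ^ 'n) set \<Rightarrow> bool"
  where "mv_analytic_on g S \<longleftrightarrow>
    (\<forall>a\<in>S. \<exists>r>0. \<exists>c :: ('n \<Rightarrow> nat) \<Rightarrow> complex. \<forall>x\<in>ball a r.
       ((\<lambda>\<alpha>. c \<alpha> * (\<Prod>i\<in>UNIV. (x $ i - a $ i) ^ \<alpha> i)) has_sum g x) UNIV)"

definition mv_analytic_map_on :: "(complex ^ 'n \<Rightarrow> complex ^ 'm) \<Rightarrow> (complex ^ 'n) set \<Rightarrow> bool"
  where "mv_analytic_map_on f S \<longleftrightarrow> (\<forall>i. mv_analytic_on (\<lambda>x. f x $ i) S)"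

text \<open>For a complex differentiable function the real Frechet derivative is complex linear, so its
  value at the \<open>j\<close>-th unit vector is the complex partial derivative. The same remark applies
  to the library constant \<^const>\<open>jacobian\<close>, which is used below at type \<open>complex\<close>.\<close>

definition cgradient :: "(complex ^ 'n \<Rightarrow> complex) \<Rightarrow> complex ^ 'n \<Rightarrow> complex ^ 'n"
  where "cgradient R x = (\<chi> j. frechet_derivative R (at x) (axis j 1))"

definition local_analytic_diffeo :: "(complex ^ 'n \<Rightarrow> complex ^ 'n) \<Rightarrow> (complex ^ 'n) set \<Rightarrow> bool"
  where "local_analytic_diffeo f U \<longleftrightarrow>
    open U \<and> 0 \<in> U \<and> mv_analytic_map_on f U \<and> f 0 = 0 \<and> invertible (jacobian f (at 0))"

definition charpoly :: "'a::comm_ring_1 ^ 'n ^ 'n \<Rightarrow> 'a poly"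
  where "charpoly A = det (mat [:0, 1:] - map_matrix (\<lambda>a. [:a:]) A)"

definition eigenvalues_with_mult :: "complex ^ 'n ^ 'n \<Rightarrow> complex ^ 'n \<Rightarrow> bool"
  where "eigenvalues_with_mult A \<mu> \<longleftrightarrow> charpoly A = (\<Prod>i\<in>UNIV. [:- (\<mu> $ i), 1:])"

definition mv_powi :: "complex ^ 'n \<Rightarrow> int ^ 'n \<Rightarrow> complex"
  where "mv_powi \<mu> k = (\<Prod>i\<in>UNIV. (\<mu> $ i) powi (k $ i))"

interpretation int_vec: module "(*s) :: int \<Rightarrow> int ^ 'n \<Rightarrow> int ^ 'n"
  by unfold_locales (simp_all add: vec_eq_iff algebra_simps)

text \<open>The maximum is over a nonempty set of numbers bounded by \<open>CARD('n)\<close>, because a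
  \<open>\<int>\<close>-independent subset of \<open>\<int>\<^sup>n\<close> has at most \<open>n\<close> elements.\<close>

definition int_span_rank :: "(int ^ 'n) set \<Rightarrow> nat"
  where "int_span_rank K = Max {card B | B. B \<subseteq> int_vec.span K \<and> int_vec.independent B}"

text \<open>The meromorphic function \<open>G / H\<close> is represented by the pair \<open>G\<close>, \<open>H\<close>. The set
  \<open>W\<close> stands for the neighbourhood of the origin; as \<open>f\<close> need not map it into itself,
  invariance is required at those points of \<open>W\<close> whose image lies in \<open>W\<close>.\<close>

definition meromorphic_first_integral ::
  "(complex ^ 'n \<Rightarrow> complex ^ 'n) \<Rightarrow> (complex ^ 'n) set \<Rightarrow>
   (complex ^ 'n \<Rightarrow> complex) \<Rightarrow> (complex ^ 'n \<Rightarrow> complex) \<Rightarrow> bool"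
  where "meromorphic_first_integral f W G H \<longleftrightarrow>
    mv_analytic_on G W \<and> mv_analytic_on H W \<and> (\<exists>x\<in>W. H x \<noteq> 0) \<and>
    (\<forall>x\<in>W. f x \<in> W \<longrightarrow> G (f x) * H x = G x * H (f x))"

text \<open>Gradients are taken only where no denominator vanishes. Together with injectivity of the
  indexing, independence of the set of gradients is independence of the family.\<close>

definition functionally_independent ::
  "(complex ^ 'n) set \<Rightarrow> nat \<Rightarrow>
   (nat \<Rightarrow> complex ^ 'n \<Rightarrow> complex) \<Rightarrow> (nat \<Rightarrow> complex ^ 'n \<Rightarrow> complex) \<Rightarrow> bool"
  where "functionally_independent W m G H \<longleftrightarrow>
    (\<exists>D. open D \<and> D \<subseteq> W \<and> W \<subseteq> closure D \<and>
      (\<forall>x\<in>D. (\<forall>i<m. H i x \<noteq> 0) \<and>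
        inj_on (\<lambda>i. cgradient (\<lambda>y. G i y / H i y) x) {..<m} \<and>
        vec.independent ((\<lambda>i. cgradient (\<lambda>y. G i y / H i y) x) ` {..<m})))"

end

theory Submission
  imports Defs "Jordan_Normal_Form.Schur_Decomposition"
begin

text \<open>
  The proof compares the number of polynomial expressions in the first integrals with the number
  of monomials that may occur as their leading terms.

  \<^bold>\<open>Leading exponents are resonant.\<close> In linear coordinates that make \<open>D f(0)\<close> triangular, order the
  monomials first by degree and then lexicographically. Substituting \<open>f\<close> into a power series
  with lowest term \<open>p x\<^sup>\<alpha>\<close> gives a series with lowest term \<open>p \<mu>\<^sup>\<alpha> x\<^sup>\<alpha>\<close>. Hence, if \<open>P / Q\<close> is a
  first integral, the lowest exponents \<open>\<alpha>\<close> of \<open>P\<close> and \<open>\<beta>\<close> of \<open>Q\<close> satisfy \<open>\<mu>\<^sup>\<alpha> = \<mu>\<^sup>\<beta>\<close>, that is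
  \<open>\<mu>\<^bsup>\<alpha>-\<beta>\<^esup> = 1\<close>. This is \<open>leading_exponents_resonant\<close>. The monomial order is realised by an integer
  weight \<open>w\<close>, so that leading terms are limits along the single curve \<open>t \<mapsto> (t\<^bsup>w i\<^esup>)\<^sub>i\<close>.

  \<^bold>\<open>Counting.\<close> Let \<open>R\<^sub>i = G\<^sub>i / H\<^sub>i\<close>, \<open>i < m\<close>, be the first integrals. For every \<open>N\<close> the \<open>(N+1)\<^sup>m\<close> monomials in
  the \<open>R\<^sub>i\<close> of degree at most \<open>N\<close> in each \<open>R\<^sub>i\<close> have the common denominator \<open>Q = \<Prod>\<^sub>i H\<^sub>i\<^sup>N\<close>; every linear
  combination \<open>P\<close> of their numerators gives again a first integral \<open>P / Q\<close>. So all leading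
  exponents of such \<open>P\<close> lie in one class \<open>{\<alpha>. \<mu>\<^sup>\<alpha> = \<mu>\<^sup>\<beta>}\<close>. Such a class is determined by \<open>r\<close> of its
  coordinates, where \<open>r\<close> is at most the rank of the lattice of all \<open>k\<close> with \<open>\<mu>\<^sup>k = 1\<close>
  (\<open>determining_coordinates\<close>), so it has at most \<open>(M+1)\<^sup>r\<close> elements of degree at most \<open>M\<close>. If \<open>r < m\<close> and
  \<open>M = C N\<close> with \<open>N\<close> large, this is smaller than \<open>(N+1)\<^sup>m\<close>, and linear algebra yields a nontrivial
  combination \<open>P\<close> whose coefficients at all these exponents vanish. The lowest exponent of \<open>P\<close>
  must then have degree larger than \<open>C N\<close>.

  \<^bold>\<open>Zero estimate.\<close> Functional independence excludes this for a suitable constant \<open>C\<close>: a nontrivial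
  \<open>P\<close> vanishes at the origin to order at most \<open>C N\<close> (\<open>zero_estimate\<close>). Near a point close to the
  origin the map \<open>(R\<^sub>i)\<^sub>i\<close> covers a polydisc, so \<open>P / Q\<close>, a polynomial in the \<open>R\<^sub>i\<close>, is somewhere as
  large as its largest coefficient; on the other hand a power series that vanishes to order \<open>k\<close> gains a factor
  \<open>2\<^bsup>-k\<^esup>\<close> on half of its polydisc, which beats the at most exponential growth in \<open>N\<close> of all other
  constants once \<open>k > C N\<close>.
\<close>

(* x $ i is reserved for the entries of an element x of complex ^ 'n. *)
no_notation vec_index (infixl "$" 100)

section \<open>Triangularising the linear part\<close>

text \<open>Determinants of matrices indexed by a finite type and of those indexed by numbers are the same sum
over permutations, once the index sets are identified by a bijection \<open>e\<close>; conjugation with \<open>e\<close> preserves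
the sign.\<close>

lemma det_reindex:
  fixes X :: "'a :: comm_ring_1 ^ 'n ^ 'n"
  assumes e: "bij_betw e {0..<CARD('n)} (UNIV :: 'n set)"
  shows "Determinant.det (Matrix.mat CARD('n) CARD('n) (\<lambda>(i, j). X $ e i $ e j)) = Determinants.det X"
proof -
  define n where "n = CARD('n)"
  define \<Phi> where "\<Phi> = map_permutation {0..<n} e"
  have inje: "inj_on e {0..<n}" and e': "bij_betw e {0..<n} (UNIV :: 'n set)"
    using e by (auto simp: bij_betw_def n_def)
  have bij: "bij_betw \<Phi> {p. p permutes {0..<n}} {p. p permutes (UNIV :: 'n set)}"
    unfolding \<Phi>_def
  proof (rule bij_betw_byWitness[where f' = "map_permutation UNIV (inv_into {0..<n} e)"])
    show "\<forall>p\<in>{p. p permutes {0..<n}}.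
        map_permutation UNIV (inv_into {0..<n} e) (map_permutation {0..<n} e p) = p"
      using map_permutation_compose_inv[OF e'] inje by (simp add: inv_into_f_f)
    show "\<forall>p\<in>{p. p permutes UNIV}.
        map_permutation {0..<n} e (map_permutation UNIV (inv_into {0..<n} e) p) = p"
      using map_permutation_compose_inv[OF bij_betw_inv_into[OF e']] e'
      by (simp add: f_inv_into_f bij_betw_def)
    show "map_permutation {0..<n} e ` {p. p permutes {0..<n}} \<subseteq> {p. p permutes UNIV}"
      using map_permutation_permutes[OF e'] by blast
    show "map_permutation UNIV (inv_into {0..<n} e) ` {p. p permutes UNIV} \<subseteq> {p. p permutes {0..<n}}"
      using map_permutation_permutes[OF bij_betw_inv_into[OF e']] by blast
  qed
  have "Determinants.det X = (\<Sum>p | p permutes {0..<n}. of_int (sign (\<Phi> p)) * (\<Prod>i\<in>UNIV. X $ i $ \<Phi> p i))"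
    unfolding Determinants.det_def by (rule sum.reindex_bij_betw[OF bij, symmetric])
  also have "\<dots> = (\<Sum>p | p permutes {0..<n}. of_int (sign p) * (\<Prod>i = 0..<n. X $ e i $ e (p i)))"
  proof (rule sum.cong[OF refl], clarify)
    fix p assume p: "p permutes {0..<n}"
    have "sign (\<Phi> p) = sign p"
      unfolding \<Phi>_def by (rule sign_map_permutation[OF inje p]) simp
    moreover have "(\<Prod>i\<in>UNIV. X $ i $ \<Phi> p i) = (\<Prod>i = 0..<n. X $ e i $ \<Phi> p (e i))"
      by (rule prod.reindex_bij_betw[OF e', symmetric])
    moreover have "\<dots> = (\<Prod>i = 0..<n. X $ e i $ e (p i))"
      by (intro prod.cong refl) (use inje in \<open>auto simp: \<Phi>_def map_permutation_apply\<close>)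
    ultimately show "of_int (sign (\<Phi> p)) * (\<Prod>i\<in>UNIV. X $ i $ \<Phi> p i)
        = of_int (sign p) * (\<Prod>i = 0..<n. X $ e i $ e (p i))" by simp
  qed
  also have "\<dots> = Determinant.det (Matrix.mat n n (\<lambda>(i, j). X $ e i $ e j))"
    unfolding Determinant.det_def
    by (auto intro!: sum.cong prod.cong simp: permutes_in_image dest: permutes_in_image)
  finally show ?thesis by (simp add: n_def)
qed

text \<open>Schur's theorem, carried over to matrices indexed by a finite type. The type \<open>'n\<close> has no order, so
the order of the basis is recorded by the numbering \<open>ord\<close>. Since the Schur decomposition
realises any prescribed order of the eigenvalues on the diagonal, the \<open>i\<close>-th diagonal entry can
be taken to be \<open>\<mu> $ i\<close>.\<close>

lemma triangularization:
  fixes A :: "complex ^ 'n ^ 'n"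
  assumes "eigenvalues_with_mult A \<mu>"
  obtains P Q :: "complex ^ 'n ^ 'n" and ord :: "'n \<Rightarrow> nat"
  where "bij_betw ord UNIV {..<CARD('n)}" "P ** Q = Finite_Cartesian_Product.mat 1"
    "\<And>i j. ord j < ord i \<Longrightarrow> (Q ** A ** P) $ i $ j = 0" "\<And>i. (Q ** A ** P) $ i $ i = \<mu> $ i"
proof -
  define n where "n = CARD('n)"
  obtain e where e: "bij_betw e {0..<n} (UNIV :: 'n set)"
    using ex_bij_betw_nat_finite[of "UNIV :: 'n set"] by (auto simp: n_def)
  have inje: "inj_on e {0..<n}" and rane: "e ` {0..<n} = UNIV" using e by (auto simp: bij_betw_def)
  define ord where "ord = inv_into {0..<n} e"
  have ordlt: "ord i < n" and eord: "e (ord i) = i" for i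
    using inv_into_into[of i e "{0..<n}"] f_inv_into_f[of i e "{0..<n}"] rane by (auto simp: ord_def)
  have orde: "ord (e k) = k" if "k < n" for k
    using inje that by (simp add: ord_def)
  have ord: "bij_betw ord UNIV {..<n}"
    using bij_betw_inv_into[OF e] by (simp add: ord_def lessThan_atLeast0)
  define tomat where "tomat X = Matrix.mat n n (\<lambda>(i, j). X $ e i $ e j)" for X :: "complex ^ 'n ^ 'n"
  have [simp]: "tomat X \<in> carrier_mat n n" "dim_row (tomat X) = n" "dim_col (tomat X) = n" for X
    by (auto simp: tomat_def)
  define \<mu>s where "\<mu>s = map (\<lambda>k. \<mu> $ e k) [0..<n]"
  have "char_poly_matrix (tomat A)
      = Matrix.mat n n (\<lambda>(i, j). (Finite_Cartesian_Product.mat [:0, 1:] - map_matrix (\<lambda>a. [:a:]) A) $ e i $ e j)"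
    by (rule eq_matI)
      (auto simp: char_poly_matrix_def tomat_def Finite_Cartesian_Product.mat_def map_matrix_def
        inj_on_eq_iff[OF inje])
  then have "char_poly (tomat A) = charpoly A"
    unfolding char_poly_def charpoly_def
    by (simp only: n_def det_reindex[OF e[unfolded n_def]])
  also have "\<dots> = (\<Prod>i\<in>UNIV. [:- (\<mu> $ i), 1:])"
    using assms by (simp add: eigenvalues_with_mult_def)
  also have "\<dots> = (\<Prod>k = 0..<n. [:- (\<mu> $ e k), 1:])"
    by (rule prod.reindex_bij_betw[OF e, symmetric])
  also have "\<dots> = (\<Prod>a\<leftarrow>\<mu>s. [:- a, 1:])"
    by (simp add: \<mu>s_def prod.distinct_set_conv_list[symmetric] o_def)
  finally have cp: "char_poly (tomat A) = (\<Prod>a\<leftarrow>\<mu>s. [:- a, 1:])" .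
  have tA: "tomat A \<in> carrier_mat n n" by simp
  obtain B P Q where BPQ: "schur_decomposition (tomat A) \<mu>s = (B, P, Q)"
    by (cases "schur_decomposition (tomat A) \<mu>s")
  have schur: "similar_mat_wit (tomat A) B P Q" "upper_triangular B" "diag_mat B = \<mu>s"
    using schur_decomposition[OF tA cp BPQ] by auto
  have PQ: "P * Q = 1\<^sub>m n" "Q * P = 1\<^sub>m n" "tomat A = P * B * Q"
    "B \<in> carrier_mat n n" "P \<in> carrier_mat n n" "Q \<in> carrier_mat n n"
    using similar_mat_witD2[OF tA schur(1)] by auto
  define frommat where "frommat X = (\<chi> i j. X $$ (ord i, ord j))" for X :: "complex Matrix.mat"
  have fm: "frommat (X * Y) = frommat X ** frommat Y"
    if "X \<in> carrier_mat n n" "Y \<in> carrier_mat n n" for X Y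
  proof -
    have "(X * Y) $$ (ord i, ord j) = (\<Sum>k\<in>UNIV. X $$ (ord i, ord k) * Y $$ (ord k, ord j))" for i j
      using that ordlt sum.reindex_bij_betw[OF ord, of "\<lambda>k. X $$ (ord i, k) * Y $$ (k, ord j)"]
      by (simp add: scalar_prod_def lessThan_atLeast0)
    then show ?thesis by (simp add: frommat_def matrix_matrix_mult_def)
  qed
  have ft: "frommat (tomat X) = X" for X
    by (simp add: frommat_def tomat_def ordlt eord vec_eq_iff)
  have f1: "frommat (1\<^sub>m n) = Finite_Cartesian_Product.mat 1"
    using ord by (auto simp: frommat_def Finite_Cartesian_Product.mat_def vec_eq_iff ordlt bij_betw_def inj_eq)
  have QAP: "Q * tomat A * P = B"
  proof -
    have "Q * tomat A * P = (Q * P) * B * (Q * P)"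
      unfolding PQ(3) using PQ(4-6) by (simp add: assoc_mult_mat[of _ n n _ n _ n])
    also have "\<dots> = B" using PQ by simp
    finally show ?thesis .
  qed
  have fB: "frommat Q ** A ** frommat P = frommat B"
    using fm[OF mult_carrier_mat[OF PQ(6) tA] PQ(5)] fm[OF PQ(6) tA] by (simp add: QAP ft)
  show thesis
  proof (rule that)
    show "bij_betw ord UNIV {..<CARD('n)}" using ord by (simp add: n_def)
    show "frommat P ** frommat Q = Finite_Cartesian_Product.mat 1"
      using fm[of P Q] PQ f1 by simp
    show "(frommat Q ** A ** frommat P) $ i $ j = 0" if "ord j < ord i" for i j
      unfolding fB using schur(2) PQ(4) that ordlt by (auto simp: frommat_def upper_triangular_def)
    show "(frommat Q ** A ** frommat P) $ i $ i = \<mu> $ i" for i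
    proof -
      have "B $$ (ord i, ord i) = diag_mat B ! ord i"
        using PQ(4) ordlt by (simp add: diag_mat_def)
      then show ?thesis
        unfolding fB schur(3) using ordlt eord by (simp add: frommat_def \<mu>s_def)
    qed
  qed
qed

hide_const (open) Matrix.mat Matrix.row Determinant.det
hide_fact (open) Matrix.vec_eq_iff Matrix.mat_def Matrix.row_def Determinant.det_def

lemma poly_det:
  fixes X :: "'a :: comm_ring_1 poly ^ 'n ^ 'n"
  shows "poly (det X) t = det (\<chi> i j. poly (X $ i $ j) t)"
  by (simp add: det_def poly_sum poly_prod)

lemma eigenvalues_nonzero:
  fixes A :: "complex ^ 'n ^ 'n"
  assumes "eigenvalues_with_mult A \<mu>" "invertible A"
  shows "\<mu> $ i \<noteq> 0"
proof
  assume "\<mu> $ i = 0"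
  then have "poly (charpoly A) 0 = 0"
    using assms(1) by (auto simp: eigenvalues_with_mult_def poly_prod intro!: prod_zero)
  moreover have "(\<chi> i j. poly ((mat [:0, 1:] - map_matrix (\<lambda>a. [:a:]) A) $ i $ j) 0) = (\<chi> i. (-1) *s A $ i)"
    by (simp add: vec_eq_iff mat_def map_matrix_def)
  then have "poly (charpoly A) 0 = (-1) ^ CARD('n) * det A"
    unfolding charpoly_def poly_det using Determinants.det_rows_mul[of "\<lambda>_. -1" "\<lambda>i. A $ i"]
    by (simp only: vec_lambda_eta prod_constant)
  ultimately show False
    using assms(2) invertible_det_nz[of A] by simp
qed

section \<open>Power series with a weighted absolute norm\<close>

definition mpow :: "complex ^ 'n \<Rightarrow> ('n \<Rightarrow> nat) \<Rightarrow> complex"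
  where "mpow x \<alpha> = (\<Prod>i\<in>UNIV. (x $ i) ^ \<alpha> i)"

definition polydisc :: "real \<Rightarrow> (complex ^ 'n) set"
  where "polydisc r = {x. \<forall>i. norm (x $ i) \<le> r}"

text \<open>The bound \<open>M\<close> for the norm \<open>\<Sum>\<^sub>\<alpha> \<bar>b\<^sub>\<alpha>\<bar> r\<^bsup>\<bar>\<alpha>\<bar>\<^esup>\<close> is part of the predicate because this norm is
submultiplicative: bounds for products and for substitutions then come together with their convergence.\<close>

definition pseries ::
  "real \<Rightarrow> real \<Rightarrow> (('n::finite \<Rightarrow> nat) \<Rightarrow> complex) \<Rightarrow> (complex ^ 'n \<Rightarrow> complex) \<Rightarrow> bool"
  where "pseries r M b F \<longleftrightarrow>
    (\<lambda>\<alpha>. norm (b \<alpha>) * r ^ sum \<alpha> UNIV) summable_on UNIV \<and>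
    (\<Sum>\<^sub>\<infinity>\<alpha>. norm (b \<alpha>) * r ^ sum \<alpha> UNIV) \<le> M \<and>
    (\<forall>x\<in>polydisc r. ((\<lambda>\<alpha>. b \<alpha> * mpow x \<alpha>) has_sum F x) UNIV)"

lemma mpow_add: "mpow x (\<lambda>i. \<alpha> i + \<beta> i) = mpow x \<alpha> * mpow x \<beta>"
  by (simp add: mpow_def power_add prod.distrib)

lemma mpow_zero [simp]: "mpow x (\<lambda>i. 0) = 1"
  by (simp add: mpow_def)

lemma mpow_unit [simp]: "mpow x (\<lambda>i. if i = j then 1 else 0) = x $ j"
proof -
  have "mpow x (\<lambda>i. if i = j then 1 else 0) = (\<Prod>i\<in>UNIV. if i = j then x $ i else 1)"
    unfolding mpow_def by (intro prod.cong) auto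
  then show ?thesis by (simp add: prod.delta)
qed

lemma norm_mpow_le:
  assumes "\<And>i. norm (x $ i) \<le> s ^ w i * r" "0 \<le> s" "0 \<le> r"
  shows "norm (mpow x \<alpha>) \<le> s ^ (\<Sum>i\<in>UNIV. w i * \<alpha> i) * r ^ sum \<alpha> UNIV"
proof -
  have "norm (mpow x \<alpha>) = (\<Prod>i\<in>UNIV. norm (x $ i) ^ \<alpha> i)"
    by (simp add: mpow_def norm_power flip: prod_norm)
  also have "\<dots> \<le> (\<Prod>i\<in>UNIV. (s ^ w i * r) ^ \<alpha> i)"
    by (intro prod_mono conjI zero_le_power power_mono assms) auto
  also have "\<dots> = s ^ (\<Sum>i\<in>UNIV. w i * \<alpha> i) * r ^ sum \<alpha> UNIV"
    by (simp add: power_mult_distrib prod.distrib power_sum power_mult)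
  finally show ?thesis .
qed

lemma norm_mpow_polydisc:
  assumes "x \<in> polydisc r" "0 \<le> r"
  shows "norm (mpow x \<alpha>) \<le> r ^ sum \<alpha> UNIV"
  using norm_mpow_le[of x 1 "\<lambda>_. 1" r \<alpha>] assms by (simp add: polydisc_def)

lemma pseries_nonneg: "pseries r M b F \<Longrightarrow> 0 \<le> r \<Longrightarrow> 0 \<le> M"
proof -
  assume "pseries r M b F" "0 \<le> r"
  then have "0 \<le> (\<Sum>\<^sub>\<infinity>\<alpha>. norm (b \<alpha>) * r ^ sum \<alpha> UNIV)"
    by (intro infsum_nonneg) simp
  also have "\<dots> \<le> M"
    using \<open>pseries r M b F\<close> by (simp add: pseries_def)
  finally show ?thesis .
qed

lemma pseries_has_sum:
  "pseries r M b F \<Longrightarrow> x \<in> polydisc r \<Longrightarrow> ((\<lambda>\<alpha>. b \<alpha> * mpow x \<alpha>) has_sum F x) UNIV"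
  by (simp add: pseries_def)

lemma pseries_weaken: "pseries r M b F \<Longrightarrow> M \<le> M' \<Longrightarrow> pseries r M' b F"
  by (auto simp: pseries_def)

lemma pseries_shrink:
  assumes "pseries r M b F" "0 \<le> r'" "r' \<le> r"
  shows "pseries r' M b F"
proof -
  have le: "norm (b \<alpha>) * r' ^ sum \<alpha> UNIV \<le> norm (b \<alpha>) * r ^ sum \<alpha> UNIV" for \<alpha>
    by (intro mult_left_mono power_mono assms) auto
  have sm: "(\<lambda>\<alpha>. norm (b \<alpha>) * r ^ sum \<alpha> UNIV) summable_on UNIV"
    using assms by (simp add: pseries_def)
  have sm': "(\<lambda>\<alpha>. norm (b \<alpha>) * r' ^ sum \<alpha> UNIV) summable_on UNIV"
    by (rule summable_on_comparison_test[OF sm]) (use le assms in auto)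
  have "(\<Sum>\<^sub>\<infinity>\<alpha>. norm (b \<alpha>) * r' ^ sum \<alpha> UNIV) \<le> (\<Sum>\<^sub>\<infinity>\<alpha>. norm (b \<alpha>) * r ^ sum \<alpha> UNIV)"
    by (rule infsum_mono[OF sm' sm le])
  moreover have "polydisc r' \<subseteq> (polydisc r :: (complex ^ 'a) set)"
    using assms by (auto simp: polydisc_def intro: order_trans)
  ultimately show ?thesis
    using assms sm' unfolding pseries_def by (auto intro: order_trans)
qed

text \<open>A series whose terms all have weight at least \<open>k\<close> gains the factor \<open>s\<^sup>k\<close> when the coordinates are scaled
by \<open>s\<^bsup>w i\<^esup>\<close>, as every single term does. With constant weight one this is a Schwarz lemma, and it serves
for the zero estimate and for the derivative at the origin; with general weights it isolates leading terms.\<close>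

lemma pseries_tail_bound:
  assumes F: "pseries r M b F" and "0 \<le> r" "0 \<le> s" "s \<le> 1"
    and x: "\<And>i. norm (x $ i) \<le> s ^ w i * r"
    and k: "\<And>\<alpha>. b \<alpha> \<noteq> 0 \<Longrightarrow> k \<le> (\<Sum>i\<in>UNIV. w i * \<alpha> i)"
  shows "norm (F x) \<le> s ^ k * M"
proof -
  have "s ^ w i * r \<le> 1 * r" for i
    by (intro mult_right_mono power_le_one) (use assms in auto)
  then have xr: "x \<in> polydisc r"
    unfolding polydisc_def using x order_trans by fastforce
  have sm: "(\<lambda>\<alpha>. norm (b \<alpha>) * r ^ sum \<alpha> UNIV) summable_on UNIV"
    and M: "(\<Sum>\<^sub>\<infinity>\<alpha>. norm (b \<alpha>) * r ^ sum \<alpha> UNIV) \<le> M"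
    using F by (auto simp: pseries_def)
  have le: "norm (b \<alpha> * mpow x \<alpha>) \<le> s ^ k * (norm (b \<alpha>) * r ^ sum \<alpha> UNIV)" for \<alpha>
  proof (cases "b \<alpha> = 0")
    case False
    have "s ^ (\<Sum>i\<in>UNIV. w i * \<alpha> i) \<le> s ^ k"
      using assms k[OF False] by (intro power_decreasing) auto
    then have "norm (mpow x \<alpha>) \<le> s ^ k * r ^ sum \<alpha> UNIV"
      using norm_mpow_le[OF x \<open>0 \<le> s\<close> \<open>0 \<le> r\<close>, of \<alpha>] \<open>0 \<le> r\<close>
      by (meson mult_right_mono order_trans zero_le_power)
    then have "norm (b \<alpha>) * norm (mpow x \<alpha>) \<le> norm (b \<alpha>) * (s ^ k * r ^ sum \<alpha> UNIV)"
      by (rule mult_left_mono) auto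
    then show ?thesis
      by (simp add: norm_mult mult.left_commute)
  qed auto
  have "norm (F x) \<le> s ^ k * (\<Sum>\<^sub>\<infinity>\<alpha>. norm (b \<alpha>) * r ^ sum \<alpha> UNIV)"
    by (rule norm_infsum_le[OF pseries_has_sum[OF F xr]
          has_sum_cmult_right[OF has_sum_infsum[OF sm]] le])
  also have "\<dots> \<le> s ^ k * M"
    using M \<open>0 \<le> s\<close> by (intro mult_left_mono) auto
  finally show ?thesis .
qed

lemma pseries_bound:
  assumes "pseries r M b F" "0 \<le> r" "x \<in> polydisc r"
  shows "norm (F x) \<le> M"
  using pseries_tail_bound[OF assms(1,2), of 1 x "\<lambda>_. 1" 0] assms by (auto simp: polydisc_def)

text \<open>Completeness of the weighted norm: the double series is absolutely summable, so the two summations may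
be interchanged. Products and substitutions are both special cases of such sums.\<close>

lemma pseries_infinite_sum:
  fixes F :: "'k \<Rightarrow> complex ^ 'n \<Rightarrow> complex"
  assumes r: "0 < r" and F: "\<And>k. pseries r (A k) (b k) (F k)"
    and A: "(A has_sum M) UNIV"
    and S: "\<And>x. x \<in> polydisc r \<Longrightarrow> ((\<lambda>k. F k x) has_sum S x) UNIV"
  shows "pseries r M (\<lambda>\<alpha>. \<Sum>\<^sub>\<infinity>k. b k \<alpha>) S"
proof -
  define u where "u = (\<lambda>(k, \<alpha>). norm (b k \<alpha>) * r ^ sum \<alpha> UNIV)"
  have u0: "0 \<le> u z" for z
    using r by (auto simp: u_def split: prod.splits)
  define U where "U k = (\<Sum>\<^sub>\<infinity>\<alpha>. u (k, \<alpha>))" for k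
  have hU: "((\<lambda>\<alpha>. u (k, \<alpha>)) has_sum U k) UNIV" and UA: "U k \<le> A k" for k
    using F[of k] by (auto simp: u_def U_def pseries_def)
  have U0: "0 \<le> U k" for k
    using has_sum_nonneg[OF hU] u0 by auto
  have sU: "U summable_on UNIV"
    by (rule summable_on_comparison_test[OF has_sum_imp_summable[OF A]]) (use UA U0 in auto)
  have su: "u summable_on UNIV \<times> UNIV"
    by (rule summable_on_SigmaI[OF hU sU]) (use u0 in auto)
  have UM: "infsum U UNIV \<le> M"
    using has_sum_mono[OF has_sum_infsum[OF sU] A] UA by auto
  have hu: "(u has_sum infsum U UNIV) (UNIV \<times> UNIV)"
    by (rule has_sum_SigmaI[OF hU has_sum_infsum[OF sU] su])
  have hu': "((\<lambda>(\<alpha>, k). u (k, \<alpha>)) has_sum infsum U UNIV) (UNIV \<times> UNIV)"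
    using hu by (subst has_sum_swap) (simp add: case_prod_unfold)
  have col: "(\<lambda>k. u (k, \<alpha>)) summable_on UNIV" for \<alpha>
    using summable_on_SigmaD1[OF has_sum_imp_summable[OF hu'], of \<alpha>] by simp
  define V where "V \<alpha> = (\<Sum>\<^sub>\<infinity>k. u (k, \<alpha>))" for \<alpha>
  have hV: "((\<lambda>k. u (k, \<alpha>)) has_sum V \<alpha>) UNIV" for \<alpha>
    using col by (simp add: V_def)
  have VS: "(V has_sum infsum U UNIV) UNIV"
    by (rule has_sum_SigmaD[OF hu']) (use hV in auto)
  have absb: "(\<lambda>k. norm (b k \<alpha>)) summable_on UNIV" for \<alpha>
    using summable_on_cmult_left[OF col[of \<alpha>], of "inverse (r ^ sum \<alpha> UNIV)"] r
    by (simp add: u_def field_simps)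
  define B where "B \<alpha> = (\<Sum>\<^sub>\<infinity>k. b k \<alpha>)" for \<alpha>
  have hB: "((\<lambda>k. b k \<alpha>) has_sum B \<alpha>) UNIV" for \<alpha>
    unfolding B_def using absb[of \<alpha>] by (simp add: abs_summable_summable)
  have BV: "norm (B \<alpha>) * r ^ sum \<alpha> UNIV \<le> V \<alpha>" for \<alpha>
  proof -
    have "norm (B \<alpha>) \<le> (\<Sum>\<^sub>\<infinity>k. norm (b k \<alpha>))"
      unfolding B_def by (rule norm_infsum_bound) (rule absb)
    moreover have "V \<alpha> = (\<Sum>\<^sub>\<infinity>k. norm (b k \<alpha>)) * r ^ sum \<alpha> UNIV"
      unfolding V_def u_def using absb by (simp add: infsum_cmult_left)
    ultimately show ?thesis
      using r by (simp add: mult_right_mono)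
  qed
  have sB: "(\<lambda>\<alpha>. norm (B \<alpha>) * r ^ sum \<alpha> UNIV) summable_on UNIV"
    by (rule summable_on_comparison_test[OF has_sum_imp_summable[OF VS]]) (use BV r in auto)
  have "(\<Sum>\<^sub>\<infinity>\<alpha>. norm (B \<alpha>) * r ^ sum \<alpha> UNIV) \<le> infsum U UNIV"
    using has_sum_mono[OF has_sum_infsum[OF sB] VS] BV by auto
  moreover have "((\<lambda>\<alpha>. B \<alpha> * mpow x \<alpha>) has_sum S x) UNIV" if x: "x \<in> polydisc r" for x
  proof -
    define h where "h = (\<lambda>(k, \<alpha>). b k \<alpha> * mpow x \<alpha>)"
    have "norm (h z) \<le> u z" for z
      using norm_mpow_polydisc[OF x] r
      by (auto simp: h_def u_def norm_mult mult_left_mono split: prod.splits)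
    then have "h summable_on UNIV \<times> UNIV"
      by (intro abs_summable_summable[OF Infinite_Sum.abs_summable_on_comparison_test'[OF su]])
    then have "(h has_sum S x) (UNIV \<times> UNIV)"
      by (intro has_sum_SigmaI[OF _ S[OF x]]) (use pseries_has_sum[OF F x] in \<open>auto simp: h_def\<close>)
    then have "((\<lambda>(\<alpha>, k). h (k, \<alpha>)) has_sum S x) (UNIV \<times> UNIV)"
      by (subst has_sum_swap) (simp add: case_prod_unfold)
    then show ?thesis
      by (rule has_sum_SigmaD) (use has_sum_cmult_left[OF hB] in \<open>auto simp: h_def\<close>)
  qed
  ultimately show ?thesis
    using sB UM unfolding pseries_def B_def[symmetric] by auto
qed

lemma pseries_const:
  "pseries r (norm c) (\<lambda>\<alpha>. if \<alpha> = (\<lambda>_. 0) then c else 0) (\<lambda>x::complex^'n. c)"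
proof -
  have h: "((\<lambda>\<alpha>::'n \<Rightarrow> nat. norm (if \<alpha> = (\<lambda>_. 0) then c else 0) * r ^ sum \<alpha> UNIV) has_sum norm c) UNIV"
    by (rule has_sum_finite_neutralI[where B = "{\<lambda>_. 0}"]) auto
  show ?thesis
    unfolding pseries_def
  proof (intro conjI ballI)
    show "((\<lambda>\<alpha>. (if \<alpha> = (\<lambda>_. 0) then c else 0) * mpow x \<alpha>) has_sum c) UNIV" for x :: "complex ^ 'n"
      by (rule has_sum_finite_neutralI[where B = "{\<lambda>_. 0}"]) auto
  qed (use h in \<open>auto simp: has_sum_imp_summable infsumI\<close>)
qed

lemma pseries_cmult:
  assumes "pseries r M b F"
  shows "pseries r (norm c * M) (\<lambda>\<alpha>. c * b \<alpha>) (\<lambda>x. c * F x)"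
  unfolding pseries_def
proof (intro conjI ballI)
  have sm: "(\<lambda>\<alpha>. norm (b \<alpha>) * r ^ sum \<alpha> UNIV) summable_on UNIV"
    and M: "(\<Sum>\<^sub>\<infinity>\<alpha>. norm (b \<alpha>) * r ^ sum \<alpha> UNIV) \<le> M"
    using assms by (auto simp: pseries_def)
  show "(\<lambda>\<alpha>. norm (c * b \<alpha>) * r ^ sum \<alpha> UNIV) summable_on UNIV"
    using summable_on_cmult_right[OF sm, of "norm c"] by (simp add: norm_mult mult.assoc)
  show "(\<Sum>\<^sub>\<infinity>\<alpha>. norm (c * b \<alpha>) * r ^ sum \<alpha> UNIV) \<le> norm c * M"
    using mult_left_mono[OF M norm_ge_zero[of c]]
    by (simp add: norm_mult mult.assoc infsum_cmult_right[OF sm])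
  show "((\<lambda>\<alpha>. c * b \<alpha> * mpow x \<alpha>) has_sum c * F x) UNIV" if "x \<in> polydisc r" for x
    using has_sum_cmult_right[OF pseries_has_sum[OF assms that], of c] by (simp add: mult.assoc)
qed

lemma pseries_finite_sum:
  fixes F :: "'k \<Rightarrow> complex ^ 'n \<Rightarrow> complex"
  assumes r: "0 < r" and I: "finite I" and F: "\<And>k. k \<in> I \<Longrightarrow> pseries r (A k) (b k) (F k)"
  shows "pseries r (\<Sum>k\<in>I. A k) (\<lambda>\<alpha>. \<Sum>k\<in>I. b k \<alpha>) (\<lambda>x. \<Sum>k\<in>I. F k x)"
proof -
  define b' where "b' k = (if k \<in> I then b k else (\<lambda>_. 0))" for k
  define F' where "F' k = (if k \<in> I then F k else (\<lambda>_. 0))" for k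
  define A' where "A' k = (if k \<in> I then A k else 0)" for k
  have "pseries r 0 (\<lambda>_. 0) (\<lambda>_::complex^'n. 0)"
    by (simp add: pseries_def)
  then have "pseries r (A' k) (b' k) (F' k)" for k
    using F by (simp add: b'_def F'_def A'_def)
  moreover have "(A' has_sum (\<Sum>k\<in>I. A k)) UNIV"
    by (rule has_sum_finite_neutralI[of I]) (use I in \<open>auto simp: A'_def\<close>)
  moreover have "((\<lambda>k. F' k x) has_sum (\<Sum>k\<in>I. F k x)) UNIV" for x
    by (rule has_sum_finite_neutralI[of I]) (use I in \<open>auto simp: F'_def\<close>)
  ultimately have "pseries r (\<Sum>k\<in>I. A k) (\<lambda>\<alpha>. \<Sum>\<^sub>\<infinity>k. b' k \<alpha>) (\<lambda>x. \<Sum>k\<in>I. F k x)"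
    by (rule pseries_infinite_sum[OF r])
  moreover have "(\<Sum>\<^sub>\<infinity>k. b' k \<alpha>) = (\<Sum>k\<in>I. b k \<alpha>)" for \<alpha>
    by (rule infsumI, rule has_sum_finite_neutralI[of I]) (use I in \<open>auto simp: b'_def\<close>)
  ultimately show ?thesis by simp
qed

lemma has_sum_inj_support:
  fixes g :: "'a \<Rightarrow> 'b :: {topological_comm_monoid_add, t2_space}"
  assumes "inj h" "\<And>\<gamma>. \<gamma> \<notin> range h \<Longrightarrow> g \<gamma> = 0" "((\<lambda>\<beta>. g (h \<beta>)) has_sum s) UNIV"
  shows "(g has_sum s) UNIV"
proof -
  have "(g has_sum s) (range h)"
    using assms(3) by (subst has_sum_reindex[OF assms(1)]) (simp add: o_def)
  then show ?thesis
    by (subst has_sum_cong_neutral[where T = "range h"]) (use assms(2) in auto)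
qed

lemma pseries_shift:
  fixes b :: "('n::finite \<Rightarrow> nat) \<Rightarrow> complex"
  assumes F: "pseries r M b F" and r: "0 \<le> r"
  shows "\<exists>c. pseries r (r ^ sum \<alpha> UNIV * M) c (\<lambda>x. mpow x \<alpha> * F x)"
proof -
  define h where "h = (\<lambda>(\<beta>::'n \<Rightarrow> nat) i. \<alpha> i + \<beta> i)"
  define c where "c \<gamma> = (if \<gamma> \<in> range h then b (\<lambda>i. \<gamma> i - \<alpha> i) else 0)" for \<gamma>
  have inj: "inj h"
    by (auto simp: inj_def h_def fun_eq_iff)
  have ch: "c (h \<beta>) = b \<beta>" for \<beta>
    unfolding c_def by (simp add: h_def)
  have c0: "c \<gamma> = 0" if "\<gamma> \<notin> range h" for \<gamma>
    using that by (simp add: c_def)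
  have sm: "((\<lambda>\<beta>. norm (b \<beta>) * r ^ sum \<beta> UNIV) has_sum
      (\<Sum>\<^sub>\<infinity>\<beta>. norm (b \<beta>) * r ^ sum \<beta> UNIV)) UNIV"
    and M: "(\<Sum>\<^sub>\<infinity>\<beta>. norm (b \<beta>) * r ^ sum \<beta> UNIV) \<le> M"
    using F by (auto simp: pseries_def)
  have "norm (c (h \<beta>)) * r ^ sum (h \<beta>) UNIV = r ^ sum \<alpha> UNIV * (norm (b \<beta>) * r ^ sum \<beta> UNIV)" for \<beta>
    unfolding ch by (simp add: h_def sum.distrib power_add)
  note shifted = this
  have n: "((\<lambda>\<gamma>. norm (c \<gamma>) * r ^ sum \<gamma> UNIV) has_sum
      (r ^ sum \<alpha> UNIV * (\<Sum>\<^sub>\<infinity>\<beta>. norm (b \<beta>) * r ^ sum \<beta> UNIV))) UNIV"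
    by (rule has_sum_inj_support[OF inj])
      (use has_sum_cmult_right[OF sm, of "r ^ sum \<alpha> UNIV"] in \<open>simp_all add: c0 shifted\<close>)
  have v: "((\<lambda>\<gamma>. c \<gamma> * mpow x \<gamma>) has_sum mpow x \<alpha> * F x) UNIV" if x: "x \<in> polydisc r" for x
  proof (rule has_sum_inj_support[OF inj])
    have "c (h \<beta>) * mpow x (h \<beta>) = mpow x \<alpha> * (b \<beta> * mpow x \<beta>)" for \<beta>
      unfolding ch by (simp add: h_def mpow_add)
    then show "((\<lambda>\<beta>. c (h \<beta>) * mpow x (h \<beta>)) has_sum mpow x \<alpha> * F x) UNIV"
      using has_sum_cmult_right[OF pseries_has_sum[OF F x], of "mpow x \<alpha>"] by simp
  qed (simp add: c0)
  have "pseries r (r ^ sum \<alpha> UNIV * M) c (\<lambda>x. mpow x \<alpha> * F x)"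
    unfolding pseries_def
  proof (intro conjI ballI)
    show "(\<Sum>\<^sub>\<infinity>\<gamma>. norm (c \<gamma>) * r ^ sum \<gamma> UNIV) \<le> r ^ sum \<alpha> UNIV * M"
      unfolding infsumI[OF n] using M r by (intro mult_left_mono) auto
  qed (use has_sum_imp_summable[OF n] v in auto)
  then show ?thesis by blast
qed

text \<open>Expanding only the first factor gives \<open>F G = \<Sum>\<^sub>\<alpha> b\<^sub>\<alpha> x\<^sup>\<alpha> G\<close>, a sum of shifted copies of the second one. Only
the existence of coefficients and the bound for their norm are recorded.\<close>

lemma pseries_mult:
  assumes r: "0 < r" and F: "pseries r M b F" and G: "pseries r N c G"
  shows "\<exists>d. pseries r (M * N) d (\<lambda>x. F x * G x)"
proof -
  have M: "(\<Sum>\<^sub>\<infinity>\<alpha>. norm (b \<alpha>) * r ^ sum \<alpha> UNIV) \<le> M"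
    and sm: "((\<lambda>\<alpha>. norm (b \<alpha>) * r ^ sum \<alpha> UNIV) has_sum
      (\<Sum>\<^sub>\<infinity>\<alpha>. norm (b \<alpha>) * r ^ sum \<alpha> UNIV)) UNIV"
    using F by (auto simp: pseries_def)
  have N0: "0 \<le> N" using pseries_nonneg[OF G] r by simp
  have "\<exists>d. pseries r (norm (b \<alpha>) * r ^ sum \<alpha> UNIV * N) d (\<lambda>x. b \<alpha> * (mpow x \<alpha> * G x))" for \<alpha>
    using pseries_shift[OF G less_imp_le[OF r], of \<alpha>] pseries_cmult[of r _ _ _ "b \<alpha>"]
    by (metis mult.assoc)
  then obtain d where d: "pseries r (norm (b \<alpha>) * r ^ sum \<alpha> UNIV * N) (d \<alpha>)
      (\<lambda>x. b \<alpha> * (mpow x \<alpha> * G x))" for \<alpha>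
    by metis
  have "pseries r ((\<Sum>\<^sub>\<infinity>\<alpha>. norm (b \<alpha>) * r ^ sum \<alpha> UNIV) * N)
      (\<lambda>\<gamma>. \<Sum>\<^sub>\<infinity>\<alpha>. d \<alpha> \<gamma>) (\<lambda>x. F x * G x)"
    using has_sum_cmult_left[OF pseries_has_sum[OF F], of _ "G _"]
    by (intro pseries_infinite_sum[OF r d has_sum_cmult_left[OF sm]]) (simp add: mult.assoc)
  then show ?thesis
    using M N0 by (blast intro: pseries_weaken mult_right_mono)
qed

lemma pseries_power:
  assumes r: "0 < r" and F: "pseries r M b F"
  shows "\<exists>d. pseries r (M ^ k) d (\<lambda>x. F x ^ k)"
proof (induction k)
  case 0
  then show ?case using pseries_const[of r 1] by auto
next
  case (Suc k)
  then show ?case using pseries_mult[OF r F] by auto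
qed

lemma pseries_prod:
  assumes r: "0 < r" and "finite I" and "\<And>i. i \<in> I \<Longrightarrow> \<exists>b. pseries r (M i) b (F i)"
  shows "\<exists>d. pseries r (\<Prod>i\<in>I. M i) d (\<lambda>x. \<Prod>i\<in>I. F i x)"
  using assms(2,3)
proof (induction I rule: finite_induct)
  case empty
  then show ?case using pseries_const[of r 1] by auto
next
  case (insert i I)
  then show ?case using pseries_mult[OF r] by fastforce
qed

lemma pseries_coordinate: "0 \<le> r \<Longrightarrow> \<exists>b. pseries r r b (\<lambda>x. x $ j)"
  using pseries_shift[OF pseries_const[of r 1], of "\<lambda>i. if i = j then 1 else 0"] by auto

text \<open>On the polydisc of radius \<open>r / K\<close> each coordinate of \<open>T x\<close> has norm at most \<open>r\<close>, so
\<open>b\<^sub>\<alpha> (T x)\<^sup>\<alpha>\<close> has norm at most \<open>\<bar>b\<^sub>\<alpha>\<bar> r\<^bsup>\<bar>\<alpha>\<bar>\<^esup>\<close>, which is summable over \<open>\<alpha>\<close>.\<close>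

lemma pseries_linear_substitution:
  fixes T :: "complex ^ 'n ^ 'n"
  assumes F: "pseries r M b F" and r: "0 < r"
  shows "\<exists>r'>0. \<exists>b'. pseries r' M b' (\<lambda>x. F (T *v x))"
proof -
  define K where "K = 1 + (\<Sum>i\<in>UNIV. \<Sum>j\<in>UNIV. norm (T $ i $ j))"
  have "0 \<le> (\<Sum>i\<in>UNIV. \<Sum>j\<in>UNIV. norm (T $ i $ j))"
    by (intro sum_nonneg) auto
  then have K: "0 < K" by (simp add: K_def)
  define r' where "r' = r / K"
  have r': "0 < r'" using r K by (simp add: r'_def)
  have "(\<Sum>j\<in>UNIV. norm (T $ i $ j)) \<le> (\<Sum>i\<in>UNIV. \<Sum>j\<in>UNIV. norm (T $ i $ j))" for i
    by (rule member_le_sum) (auto intro: sum_nonneg)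
  then have "(\<Sum>j\<in>UNIV. norm (T $ i $ j)) \<le> K" for i
    unfolding K_def by (meson add_increasing zero_le_one)
  note rowK = this
  have rowle: "(\<Sum>j\<in>UNIV. norm (T $ i $ j) * r') \<le> r" for i
  proof -
    have "(\<Sum>j\<in>UNIV. norm (T $ i $ j)) * r' \<le> K * r'"
      using rowK r' by (intro mult_right_mono) auto
    then show ?thesis
      unfolding sum_distrib_right[symmetric] using K by (simp add: r'_def)
  qed
  have row: "\<exists>d. pseries r' r d (\<lambda>x. (T *v x) $ i)" for i
  proof -
    have "\<forall>j::'n. \<exists>b. pseries r' r' b (\<lambda>x. x $ j)"
      by (intro allI pseries_coordinate less_imp_le r')
    from choice[OF this] obtain c where "\<And>j::'n. pseries r' r' (c j) (\<lambda>x. x $ j)"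
      by blast
    then have "pseries r' (\<Sum>j\<in>UNIV. norm (T $ i $ j) * r') (\<lambda>\<alpha>. \<Sum>j\<in>UNIV. T $ i $ j * c j \<alpha>)
        (\<lambda>x. \<Sum>j\<in>UNIV. T $ i $ j * x $ j)"
      by (intro pseries_finite_sum[OF r'] pseries_cmult) auto
    from pseries_weaken[OF this rowle] show ?thesis
      by (auto simp: matrix_vector_mult_def)
  qed
  have "\<exists>d. pseries r' (norm (b \<alpha>) * r ^ sum \<alpha> UNIV) d (\<lambda>x. b \<alpha> * mpow (T *v x) \<alpha>)" for \<alpha>
  proof -
    have "\<exists>d. pseries r' (\<Prod>i\<in>UNIV. r ^ \<alpha> i) d (\<lambda>x. \<Prod>i\<in>UNIV. ((T *v x) $ i) ^ \<alpha> i)"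
    proof (rule pseries_prod[OF r'])
      show "\<exists>d. pseries r' (r ^ \<alpha> i) d (\<lambda>x. (T *v x) $ i ^ \<alpha> i)" for i
        using row[of i] pseries_power[OF r', of r _ "\<lambda>x. (T *v x) $ i"] by blast
    qed auto
    then show ?thesis
      unfolding mpow_def power_sum[symmetric] using pseries_cmult by blast
  qed
  then obtain d where d: "pseries r' (norm (b \<alpha>) * r ^ sum \<alpha> UNIV) (d \<alpha>)
      (\<lambda>x. b \<alpha> * mpow (T *v x) \<alpha>)" for \<alpha>
    by metis
  have Tx: "T *v x \<in> polydisc r" if "x \<in> polydisc r'" for x
    using row pseries_bound[OF _ _ that] r' unfolding polydisc_def by fastforce
  have "pseries r' (\<Sum>\<^sub>\<infinity>\<alpha>. norm (b \<alpha>) * r ^ sum \<alpha> UNIV) (\<lambda>\<gamma>. \<Sum>\<^sub>\<infinity>\<alpha>. d \<alpha> \<gamma>) (\<lambda>x. F (T *v x))"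
    using F Tx by (intro pseries_infinite_sum[OF r' d]) (auto simp: pseries_def)
  then show ?thesis
    using F r' pseries_weaken unfolding pseries_def[of r] by blast
qed

lemma pseries_common_radius:
  fixes F :: "nat \<Rightarrow> complex ^ 'n \<Rightarrow> complex"
  assumes "\<And>i. i < m \<Longrightarrow> \<exists>r>0. \<exists>M b. pseries r M b (F i)"
  shows "\<exists>r>0. \<forall>i<m. \<exists>M b. pseries r M b (F i)"
  using assms
proof (induction m)
  case (Suc m)
  then obtain r where r: "0 < r" "\<forall>i<m. \<exists>M b. pseries r M b (F i)" by auto
  obtain r' M' b' where r': "0 < r'" "pseries r' M' b' (F m)" using Suc.prems by blast
  have "\<exists>M b. pseries (min r r') M b (F i)" if "i < Suc m" for i
    using r r' that pseries_shrink[of r _ _ "F i" "min r r'"] pseries_shrink[of r' M' b' "F i" "min r r'"]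
    by (cases "i = m") (auto simp: less_Suc_eq, blast)
  then show ?case using r r' by (intro exI[of _ "min r r'"]) auto
qed (auto intro: exI[of _ 1])

text \<open>The bound is upward closed in order that two families can afterwards share one bound.\<close>

lemma pseries_common_bound:
  fixes F :: "nat \<Rightarrow> complex ^ 'n \<Rightarrow> complex"
  assumes "\<And>i. i < m \<Longrightarrow> \<exists>M b. pseries r M b (F i)"
  shows "\<exists>L>0. \<forall>L'\<ge>L. \<forall>i<m. \<exists>b. pseries r L' b (F i)"
proof -
  obtain M where M: "\<And>i. i < m \<Longrightarrow> \<exists>b. pseries r (M i) b (F i)" using assms by metis
  define L where "L = 1 + (\<Sum>i<m. \<bar>M i\<bar>)"
  have "M i \<le> L" if "i < m" for i
    using member_le_sum[of i "{..<m}" "\<lambda>i. \<bar>M i\<bar>"] that by (simp add: L_def)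
  moreover have "0 < L" unfolding L_def by (intro add_pos_nonneg sum_nonneg) auto
  ultimately show ?thesis
    using M pseries_weaken by (meson order_trans)
qed

section \<open>Power series of analytic functions\<close>

definition unit_exp :: "'n \<Rightarrow> 'n \<Rightarrow> nat"
  where "unit_exp j = (\<lambda>i. if i = j then 1 else 0)"

lemma mpow_unit_exp [simp]: "mpow x (unit_exp j) = x $ j"
  using mpow_unit[of x j] by (simp add: unit_exp_def)

lemma sum_unit_exp: "(\<Sum>i\<in>UNIV. w i * unit_exp (j::'n::finite) i) = (w j :: nat)"
proof -
  have "(\<Sum>i\<in>UNIV. w i * unit_exp j i) = (\<Sum>i\<in>UNIV. if i = j then w i else 0)"
    by (intro sum.cong) (auto simp: unit_exp_def)
  then show ?thesis by simp
qed

lemma exponent_degree_le_1: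
  assumes "sum \<alpha> (UNIV :: 'n::finite set) \<le> 1"
  shows "\<alpha> = (\<lambda>_. 0) \<or> (\<exists>j. \<alpha> = unit_exp j)"
proof (cases "\<alpha> = (\<lambda>_. 0)")
  case False
  then obtain j where j: "\<alpha> j \<noteq> 0" by auto
  have "sum \<alpha> UNIV = \<alpha> j + sum \<alpha> (UNIV - {j})"
    by (rule sum.remove) auto
  then have "\<alpha> j = 1" "sum \<alpha> (UNIV - {j}) = 0"
    using assms j by linarith+
  then have "\<alpha> = unit_exp j"
    by (auto simp: unit_exp_def fun_eq_iff)
  then show ?thesis by blast
qed auto

lemma norm_le_sum_components: "norm (x :: complex ^ 'n) \<le> (\<Sum>i\<in>UNIV. norm (x $ i))"
  unfolding norm_vec_def by (rule L2_set_le_sum) auto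

text \<open>An unconditionally convergent complex series converges absolutely. Applied at a corner of a small
polydisc this gives a finite weighted norm.\<close>

lemma analytic_imp_pseries:
  fixes g :: "complex ^ 'n \<Rightarrow> complex"
  assumes "mv_analytic_on g S" "a \<in> S"
  shows "\<exists>r>0. \<exists>M b. pseries r M b (\<lambda>x. g (a + x))"
proof -
  obtain r c where r: "0 < r" and c: "\<And>x. x \<in> ball a r \<Longrightarrow>
      ((\<lambda>\<alpha>. c \<alpha> * (\<Prod>i\<in>UNIV. (x $ i - a $ i) ^ \<alpha> i)) has_sum g x) UNIV"
    using assms unfolding mv_analytic_on_def by meson
  \<comment> \<open>The norm is at most the sum of the \<open>n\<close> coordinates, so this polydisc lies inside the ball.\<close>
  define r' where "r' = r / (2 * real CARD('n))"
  have r': "0 < r'" using r by (simp add: r'_def)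
  have ball: "a + x \<in> ball a r" if "x \<in> polydisc r'" for x
  proof -
    have "norm x \<le> (\<Sum>i\<in>(UNIV::'n set). r')"
      using norm_le_sum_components[of x] that
      by (intro order_trans[OF norm_le_sum_components] sum_mono) (auto simp: polydisc_def)
    also have "\<dots> < r" using r by (simp add: r'_def)
    finally show ?thesis by (simp add: dist_norm)
  qed
  have h: "((\<lambda>\<alpha>. c \<alpha> * mpow x \<alpha>) has_sum g (a + x)) UNIV" if "x \<in> polydisc r'" for x
    using c[OF ball[OF that]] by (simp add: mpow_def)
  define z :: "complex ^ 'n" where "z = (\<chi> i. of_real r')"
  have "z \<in> polydisc r'" using r' by (simp add: z_def polydisc_def)
  then have "(\<lambda>\<alpha>. c \<alpha> * mpow z \<alpha>) summable_on UNIV"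
    using h has_sum_imp_summable by blast
  then have "(\<lambda>\<alpha>. norm (c \<alpha> * mpow z \<alpha>)) summable_on UNIV"
    by (simp add: summable_on_iff_abs_summable_on_complex)
  moreover have "norm (c \<alpha> * mpow z \<alpha>) = norm (c \<alpha>) * r' ^ sum \<alpha> UNIV" for \<alpha>
    using r' by (simp add: norm_mult mpow_def z_def norm_power power_sum flip: prod_norm)
  ultimately have "(\<lambda>\<alpha>. norm (c \<alpha>) * r' ^ sum \<alpha> UNIV) summable_on UNIV"
    by simp
  then have "pseries r' (\<Sum>\<^sub>\<infinity>\<alpha>. norm (c \<alpha>) * r' ^ sum \<alpha> UNIV) c (\<lambda>x. g (a + x))"
    using h by (simp add: pseries_def)
  then show ?thesis using r' by blast
qed

lemma pseries_remove:
  fixes F :: "complex ^ 'n \<Rightarrow> complex"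
  assumes F: "pseries r M b F" and S: "finite S" and r: "0 \<le> r"
  shows "pseries r M (\<lambda>\<alpha>. if \<alpha> \<in> S then 0 else b \<alpha>) (\<lambda>x. F x - (\<Sum>\<alpha>\<in>S. b \<alpha> * mpow x \<alpha>))"
  unfolding pseries_def
proof (intro conjI ballI)
  have sm: "(\<lambda>\<alpha>. norm (b \<alpha>) * r ^ sum \<alpha> UNIV) summable_on UNIV"
    and M: "(\<Sum>\<^sub>\<infinity>\<alpha>. norm (b \<alpha>) * r ^ sum \<alpha> UNIV) \<le> M"
    using F by (auto simp: pseries_def)
  show sm': "(\<lambda>\<alpha>. norm (if \<alpha> \<in> S then 0 else b \<alpha>) * r ^ sum \<alpha> UNIV) summable_on UNIV"
    by (rule summable_on_comparison_test[OF sm]) (use r in auto)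
  have "(\<Sum>\<^sub>\<infinity>\<alpha>. norm (if \<alpha> \<in> S then 0 else b \<alpha>) * r ^ sum \<alpha> UNIV)
      \<le> (\<Sum>\<^sub>\<infinity>\<alpha>. norm (b \<alpha>) * r ^ sum \<alpha> UNIV)"
    by (rule infsum_mono[OF sm' sm]) (use r in auto)
  then show "(\<Sum>\<^sub>\<infinity>\<alpha>. norm (if \<alpha> \<in> S then 0 else b \<alpha>) * r ^ sum \<alpha> UNIV) \<le> M"
    using M by simp
  fix x :: "complex ^ 'n" assume x: "x \<in> polydisc r"
  have "((\<lambda>\<alpha>. if \<alpha> \<in> S then b \<alpha> * mpow x \<alpha> else 0) has_sum (\<Sum>\<alpha>\<in>S. b \<alpha> * mpow x \<alpha>)) UNIV"
    by (rule has_sum_finite_neutralI[of S]) (use S in auto)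
  moreover have "(\<lambda>\<alpha>. b \<alpha> * mpow x \<alpha> + - (if \<alpha> \<in> S then b \<alpha> * mpow x \<alpha> else 0))
      = (\<lambda>\<alpha>. (if \<alpha> \<in> S then 0 else b \<alpha>) * mpow x \<alpha>)"
    by auto
  ultimately
  show "((\<lambda>\<alpha>. (if \<alpha> \<in> S then 0 else b \<alpha>) * mpow x \<alpha>) has_sum
      F x - (\<Sum>\<alpha>\<in>S. b \<alpha> * mpow x \<alpha>)) UNIV"
    using has_sum_add[OF pseries_has_sum[OF F x] has_sum_uminusI] by fastforce
qed

lemma pseries_at_0:
  assumes F: "pseries r M b F" and r: "0 < r"
  shows "F 0 = b (\<lambda>_. 0)"
proof -
  have "norm (F 0 - b (\<lambda>_. 0)) \<le> 0 ^ 1 * M"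
  proof (rule pseries_tail_bound[where w = "\<lambda>_. 1" and k = 1 and r = r])
    show "pseries r M (\<lambda>\<alpha>. if \<alpha> \<in> {\<lambda>_. 0} then 0 else b \<alpha>) (\<lambda>x. F x - b (\<lambda>_. 0))"
      using pseries_remove[OF F, of "{\<lambda>_. 0}"] r by simp
    show "1 \<le> (\<Sum>i\<in>UNIV. 1 * \<alpha> i)" if "(if \<alpha> \<in> {\<lambda>_. 0} then 0 else b \<alpha>) \<noteq> 0" for \<alpha>
      using that by (cases "sum \<alpha> UNIV") (auto split: if_splits)
  qed (use r in auto)
  then show ?thesis by simp
qed

lemma pseries_has_derivative:
  fixes F :: "complex ^ 'n \<Rightarrow> complex"
  assumes F: "pseries r M b F" and r: "0 < r"
  shows "(F has_derivative (\<lambda>h. \<Sum>j\<in>UNIV. b (unit_exp j) * h $ j)) (at 0)"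
proof (rule has_derivativeI_sandwich[where e = r and H = "\<lambda>x. M / r\<^sup>2 * norm x"])
  define S where "S = insert (\<lambda>_. 0) (range (unit_exp :: 'n \<Rightarrow> 'n \<Rightarrow> nat))"
  have inj: "inj (unit_exp :: 'n \<Rightarrow> 'n \<Rightarrow> nat)"
    by (rule injI) (metis unit_exp_def zero_neq_one)
  have "(\<lambda>_. 0) \<notin> range (unit_exp :: 'n \<Rightarrow> 'n \<Rightarrow> nat)"
    by (metis (no_types, lifting) imageE unit_exp_def zero_neq_one)
  then have Ssum: "(\<Sum>\<alpha>\<in>S. b \<alpha> * mpow x \<alpha>) = F 0 + (\<Sum>j\<in>UNIV. b (unit_exp j) * x $ j)" for x
    unfolding S_def using pseries_at_0[OF F r] by (simp add: sum.reindex[OF inj] o_def)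
  have main: "norm (F x - F 0 - (\<Sum>j\<in>UNIV. b (unit_exp j) * x $ j)) \<le> (norm x / r)\<^sup>2 * M"
    if "norm x \<le> r" for x
  proof (rule pseries_tail_bound[where w = "\<lambda>_. 1" and k = 2 and r = r])
    show "pseries r M (\<lambda>\<alpha>. if \<alpha> \<in> S then 0 else b \<alpha>)
        (\<lambda>x. F x - F 0 - (\<Sum>j\<in>UNIV. b (unit_exp j) * x $ j))"
      using pseries_remove[OF F, of S] r by (simp add: Ssum S_def[symmetric] diff_diff_eq) (simp add: S_def)
    show "2 \<le> (\<Sum>i\<in>UNIV. 1 * \<alpha> i)" if "(if \<alpha> \<in> S then 0 else b \<alpha>) \<noteq> 0" for \<alpha>
      using that exponent_degree_le_1[of \<alpha>] unfolding S_def by (cases "sum \<alpha> UNIV \<le> 1") auto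
    show "norm (x $ i) \<le> (norm x / r) ^ 1 * r" for i
      using r Finite_Cartesian_Product.norm_nth_le[of x i] by simp
  qed (use r that in auto)
  show "bounded_linear (\<lambda>h. \<Sum>j\<in>UNIV. b (unit_exp j) * h $ j)"
    by (intro bounded_linear_sum bounded_linear_mult_const bounded_linear_const_mult bounded_linear_vec_nth)
  show "norm (F x - F 0 - (\<Sum>j\<in>UNIV. b (unit_exp j) * (x - 0) $ j)) / norm (x - 0) \<le> M / r\<^sup>2 * norm x"
    if "x \<noteq> 0" "dist x 0 < r" for x
    using main[of x] that r by (simp add: field_simps power2_eq_square)
  show "((\<lambda>x. M / r\<^sup>2 * norm x) \<longlongrightarrow> 0) (at 0)"
    by (intro tendsto_eq_intros) auto
qed (use r in auto)

lemma analytic_has_derivative: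
  fixes g :: "complex ^ 'n \<Rightarrow> complex"
  assumes "mv_analytic_on g S" "a \<in> S"
  shows "\<exists>c. (g has_derivative (\<lambda>h. \<Sum>j\<in>UNIV. c j * h $ j)) (at a)"
proof -
  obtain r M b where "0 < r" "pseries r M b (\<lambda>x. g (a + x))"
    using analytic_imp_pseries[OF assms] by blast
  then have "((\<lambda>x. g (a + x)) has_derivative (\<lambda>h. \<Sum>j\<in>UNIV. b (unit_exp j) * h $ j)) (at (a - a))"
    by (simp add: pseries_has_derivative)
  moreover have "((\<lambda>x. x - a) has_derivative (\<lambda>h. h)) (at a)"
    by (auto intro!: derivative_eq_intros)
  ultimately have "((\<lambda>x. g (a + (x - a))) has_derivative (\<lambda>h. \<Sum>j\<in>UNIV. b (unit_exp j) * h $ j)) (at a)"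
    by (rule has_derivative_compose[rotated])
  then show ?thesis by auto
qed

lemma has_derivative_vec_lambda:
  fixes f :: "'n::finite \<Rightarrow> 'a::real_normed_vector \<Rightarrow> complex"
  assumes "\<And>i. (f i has_derivative f' i) (at x)"
  shows "((\<lambda>x. \<chi> i. f i x) has_derivative (\<lambda>h. \<chi> i. f' i h)) (at x)"
proof -
  have ax: "bounded_linear (axis i :: complex \<Rightarrow> complex ^ 'n)" for i
  proof (rule bounded_linear_intro[of _ 1])
    have "norm (axis i z :: complex ^ 'n) \<le> (\<Sum>j\<in>UNIV. norm ((axis i z :: complex ^ 'n) $ j))" for z
      by (rule norm_le_sum_components)
    also have "\<dots> z = norm z" for z :: complex
      by (simp add: axis_def if_distrib[of norm] cong: if_cong)
    finally show "norm (axis i z :: complex ^ 'n) \<le> norm z * 1" for z by simp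
  qed (auto simp: axis_def vec_eq_iff)
  have expand: "(\<chi> i. g i) = (\<Sum>i\<in>UNIV. axis i (g i))" for g :: "'n \<Rightarrow> complex"
    by (simp add: vec_eq_iff axis_def)
  show ?thesis
    unfolding expand by (intro has_derivative_sum bounded_linear.has_derivative[OF ax] assms)
qed

text \<open>The real derivative of the quotient is complex linear, so it is the pairing with the complex gradient.\<close>

lemma analytic_quotient_gradient:
  fixes G H :: "complex ^ 'n \<Rightarrow> complex"
  assumes "mv_analytic_on G S" "mv_analytic_on H S" "x \<in> S" "H x \<noteq> 0"
  shows "((\<lambda>y. G y / H y) has_derivative
    (\<lambda>h. \<Sum>j\<in>UNIV. cgradient (\<lambda>y. G y / H y) x $ j * h $ j)) (at x)"
proof -
  obtain c d where c: "(G has_derivative (\<lambda>h. \<Sum>j\<in>UNIV. c j * h $ j)) (at x)"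
    and d: "(H has_derivative (\<lambda>h. \<Sum>j\<in>UNIV. d j * h $ j)) (at x)"
    using analytic_has_derivative[OF assms(1,3)] analytic_has_derivative[OF assms(2,3)] by blast
  define e where "e j = - G x * (inverse (H x) * d j * inverse (H x)) + c j / H x" for j
  have "(\<lambda>h. - G x * (inverse (H x) * (\<Sum>j\<in>UNIV. d j * h $ j) * inverse (H x)) + (\<Sum>j\<in>UNIV. c j * h $ j) / H x)
      = (\<lambda>h. \<Sum>j\<in>UNIV. e j * h $ j)"
  proof
    fix h :: "complex ^ 'n"
    have "- G x * (inverse (H x) * (\<Sum>j\<in>UNIV. d j * h $ j) * inverse (H x))
        = (\<Sum>j\<in>UNIV. - G x * (inverse (H x) * d j * inverse (H x)) * h $ j)"
      unfolding sum_distrib_left sum_distrib_right by (simp only: mult_ac)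
    moreover have "(\<Sum>j\<in>UNIV. c j * h $ j) / H x = (\<Sum>j\<in>UNIV. c j / H x * h $ j)"
      unfolding sum_divide_distrib by simp
    ultimately show "- G x * (inverse (H x) * (\<Sum>j\<in>UNIV. d j * h $ j) * inverse (H x))
        + (\<Sum>j\<in>UNIV. c j * h $ j) / H x = (\<Sum>j\<in>UNIV. e j * h $ j)"
      by (simp only: e_def distrib_right sum.distrib)
  qed
  then have D: "((\<lambda>y. G y / H y) has_derivative (\<lambda>h. \<Sum>j\<in>UNIV. e j * h $ j)) (at x)"
    using has_derivative_divide[OF c d assms(4)] by simp
  have "cgradient (\<lambda>y. G y / H y) x $ j = e j" for j
    by (simp add: cgradient_def frechet_derivative_at[OF D, symmetric] axis_def
        if_distrib[of "\<lambda>z. _ * z"] cong: if_cong)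
  then show ?thesis using D by simp
qed

lemma analytic_continuous_on:
  assumes "mv_analytic_on g S" shows "continuous_on S g"
  using analytic_has_derivative[OF assms] has_derivative_continuous continuous_at_imp_continuous_on
  by blast

lemma analytic_diffeo_derivative:
  fixes f :: "complex ^ 'n \<Rightarrow> complex ^ 'n"
  assumes "local_analytic_diffeo f U"
  shows "(f has_derivative (\<lambda>h. jacobian f (at 0) *v h)) (at 0)"
proof -
  have "\<exists>c. ((\<lambda>x. f x $ i) has_derivative (\<lambda>h. \<Sum>j\<in>UNIV. c j * h $ j)) (at 0)" for i
  proof -
    have "mv_analytic_on (\<lambda>x. f x $ i) U" "0 \<in> U"
      using assms by (auto simp: local_analytic_diffeo_def mv_analytic_map_on_def)
    then show ?thesis by (rule analytic_has_derivative)
  qed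
  then have "\<forall>i. \<exists>c. ((\<lambda>x. f x $ i) has_derivative (\<lambda>h. \<Sum>j\<in>UNIV. c j * h $ j)) (at 0)"
    by blast
  from choice[OF this] obtain c where
    c: "\<And>i. ((\<lambda>x. f x $ i) has_derivative (\<lambda>h. \<Sum>j\<in>UNIV. c i j * h $ j)) (at 0)" by blast
  define T where "T = (\<chi> i j. c i j)"
  have D: "(f has_derivative (\<lambda>h. T *v h)) (at 0)"
    using has_derivative_vec_lambda[of "\<lambda>i x. f x $ i", OF c] by (simp add: T_def matrix_vector_mult_def)
  then have "jacobian f (at 0) = T"
    by (simp add: jacobian_def frechet_derivative_at[OF D, symmetric] matrix_of_matrix_vector_mul)
  with D show ?thesis by simp
qed

section \<open>Leading exponents along weighted curves\<close>

text \<open>Along \<open>x\<^sub>i = t\<^bsup>w i\<^esup> y\<^sub>i(t)\<close> the monomial \<open>x\<^sup>\<beta>\<close> is of the order \<open>t\<^bsup>w\<cdot>\<beta>\<^esup>\<close>. If a single exponent \<open>\<alpha>\<close> has the smallest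
weight, all other terms together are \<open>O(t\<^bsup>d+1\<^esup>)\<close> by the tail bound. The convergent factor \<open>y\<close>
allows the lemma to be applied to the image of such a curve under a map as well.\<close>

lemma pseries_leading_term:
  fixes y :: "real \<Rightarrow> complex ^ 'n"
  assumes F: "pseries r M b F" and r: "0 < r" and w: "\<And>i. 1 \<le> w i"
    and d: "d = (\<Sum>i\<in>UNIV. w i * \<alpha> i)"
    and lead: "\<And>\<beta>. b \<beta> \<noteq> 0 \<Longrightarrow> \<beta> \<noteq> \<alpha> \<Longrightarrow> d < (\<Sum>i\<in>UNIV. w i * \<beta> i)"
    and y: "\<And>i. ((\<lambda>t. y t $ i) \<longlongrightarrow> y0 $ i) (at_right 0)"
  shows "((\<lambda>t. F (\<chi> i. of_real t ^ w i * y t $ i) / of_real t ^ d) \<longlongrightarrow> b \<alpha> * mpow y0 \<alpha>) (at_right 0)"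
proof -
  define Y where "Y = 1 + (\<Sum>i\<in>UNIV. norm (y0 $ i))"
  have Y: "0 < Y" unfolding Y_def by (intro add_pos_nonneg sum_nonneg) auto
  have "norm (y0 $ i) < Y" for i
    using member_le_sum[of i UNIV "\<lambda>i. norm (y0 $ i)"] by (simp add: Y_def)
  then have "\<forall>\<^sub>F t in at_right 0. norm (y t $ i) < Y" for i
    using order_tendstoD(2)[OF tendsto_norm[OF y]] by blast
  then have evY: "\<forall>\<^sub>F t in at_right 0. \<forall>i. norm (y t $ i) < Y"
    by (simp add: eventually_all_finite)
  \<comment> \<open>All weights are at least 1, so \<open>t0\<^bsup>w i\<^esup> Y \<le> t0 Y \<le> r\<close>, and the curve stays in the polydisc up to time \<open>t0\<close>.\<close>
  define t0 where "t0 = min 1 (r / Y)"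
  have t0: "0 < t0" "t0 \<le> 1" "t0 \<le> r / Y" using r Y by (auto simp: t0_def)
  define x where "x t = (\<chi> i. of_real t ^ w i * y t $ i)" for t
  have mx: "mpow (x t) \<alpha> = of_real t ^ d * mpow (y t) \<alpha>" for t
    unfolding x_def mpow_def d by (simp add: power_mult_distrib prod.distrib power_sum power_mult)
  have rem: "norm (F (x t) - b \<alpha> * mpow (x t) \<alpha>) \<le> (t / t0) ^ Suc d * M"
    if t: "0 < t" "t < t0" and yt: "\<forall>i. norm (y t $ i) < Y" for t
  proof (rule pseries_tail_bound[where w = w and r = r])
    show "pseries r M (\<lambda>\<beta>. if \<beta> \<in> {\<alpha>} then 0 else b \<beta>) (\<lambda>x. F x - b \<alpha> * mpow x \<alpha>)"
      using pseries_remove[OF F, of "{\<alpha>}"] r by simp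
    show "Suc d \<le> (\<Sum>i\<in>UNIV. w i * \<beta> i)" if "(if \<beta> \<in> {\<alpha>} then 0 else b \<beta>) \<noteq> 0" for \<beta>
      using that lead[of \<beta>] by (auto split: if_splits)
    show "norm (x t $ i) \<le> (t / t0) ^ w i * r" for i
    proof -
      have "t0 ^ w i \<le> t0 ^ 1"
        using t0 w[of i] by (intro power_decreasing) auto
      then have "t0 ^ w i * Y \<le> r"
        using t0 Y by (simp add: field_simps) (metis mult.commute mult_right_mono order_less_imp_le order_trans)
      then have "(t / t0) ^ w i * (t0 ^ w i * Y) \<le> (t / t0) ^ w i * r"
        using t t0 by (intro mult_left_mono) auto
      moreover have "norm (x t $ i) \<le> t ^ w i * Y"
        using t yt less_imp_le by (auto simp: x_def norm_mult norm_power intro!: mult_left_mono)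
      ultimately show ?thesis
        using t0 by (simp add: power_divide)
    qed
  qed (use t t0 r in auto)
  have ev: "\<forall>\<^sub>F t in at_right 0. norm (F (x t) / of_real t ^ d - b \<alpha> * mpow (y t) \<alpha>)
      \<le> t * (M / t0 ^ Suc d)"
  proof -
    have "\<forall>\<^sub>F t in at_right (0::real). 0 < t \<and> t < t0"
      using t0 eventually_at_right_field by blast
    then show ?thesis
      using evY
    proof eventually_elim
      case (elim t)
      then have t: "0 < t" by simp
      have "F (x t) / of_real t ^ d - b \<alpha> * mpow (y t) \<alpha>
          = (F (x t) - b \<alpha> * mpow (x t) \<alpha>) / of_real t ^ d"
        using t by (simp add: mx diff_divide_distrib)
      also have "norm \<dots> = norm (F (x t) - b \<alpha> * mpow (x t) \<alpha>) / t ^ d"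
        using t by (simp add: norm_divide norm_power)
      also have "\<dots> \<le> (t / t0) ^ Suc d * M / t ^ d"
        using rem[of t] elim by (intro divide_right_mono) auto
      also have "\<dots> = t * (M / t0 ^ Suc d)"
        using t t0 by (simp add: power_divide field_simps)
      finally show ?case .
    qed
  qed
  have "((\<lambda>t. t * (M / t0 ^ Suc d)) \<longlongrightarrow> 0) (at_right 0)"
    by (intro tendsto_eq_intros) auto
  then have "((\<lambda>t. F (x t) / of_real t ^ d - b \<alpha> * mpow (y t) \<alpha>) \<longlongrightarrow> 0) (at_right 0)"
    by (rule Lim_null_comparison[OF ev])
  moreover have "((\<lambda>t. b \<alpha> * mpow (y t) \<alpha>) \<longlongrightarrow> b \<alpha> * mpow y0 \<alpha>) (at_right 0)"
    unfolding mpow_def by (intro tendsto_intros y)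
  ultimately have "((\<lambda>t. F (x t) / of_real t ^ d - b \<alpha> * mpow (y t) \<alpha> + b \<alpha> * mpow (y t) \<alpha>)
      \<longlongrightarrow> 0 + b \<alpha> * mpow y0 \<alpha>) (at_right 0)"
    by (rule tendsto_add)
  then show ?thesis by (simp add: x_def)
qed

lemma digits_unique:
  fixes a b :: "nat \<Rightarrow> nat"
  assumes "(\<Sum>k<n. a k * B ^ k) + u * B ^ n = (\<Sum>k<n. b k * B ^ k) + v * B ^ n"
    and "\<And>k. k < n \<Longrightarrow> a k < B" "\<And>k. k < n \<Longrightarrow> b k < B"
  shows "u = v \<and> (\<forall>k<n. a k = b k)"
  using assms
proof (induction n arbitrary: u v)
  case (Suc n)
  have "a n + u * B = b n + v * B \<and> (\<forall>k<n. a k = b k)"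
    using Suc.prems by (intro Suc.IH) (auto simp: algebra_simps)
  moreover from this have "(a n + u * B) mod B = (b n + v * B) mod B" by simp
  then have "a n = b n" using Suc.prems by simp
  moreover have "0 < B" using Suc.prems(2)[of n] by simp
  ultimately show ?case by (auto simp: less_Suc_eq)
qed auto

text \<open>On exponents with digits below \<open>B\<close> the weighted degree \<open>w\<cdot>\<alpha>\<close> is a number in base \<open>B\<close> whose
leading part is the total degree and whose lower digits are the entries of \<open>\<alpha>\<close>. Comparing weights thus
amounts to comparing degrees first and then the entries lexicographically.\<close>

definition lex_weight :: "nat \<Rightarrow> ('n::finite \<Rightarrow> nat) \<Rightarrow> 'n \<Rightarrow> nat"
  where "lex_weight B ord i = B ^ CARD('n) + B ^ ord i"

lemma lex_weight_sum:
  fixes \<beta> :: "'n::finite \<Rightarrow> nat"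
  shows "(\<Sum>i\<in>UNIV. lex_weight B ord i * \<beta> i)
    = (\<Sum>i\<in>UNIV. \<beta> i * B ^ ord i) + sum \<beta> UNIV * B ^ CARD('n)"
  by (simp add: lex_weight_def algebra_simps sum.distrib sum_distrib_left sum_distrib_right)

text \<open>The weights separate only the exponents of degree below \<open>B\<close>, but a nonzero coefficient of degree at most \<open>M\<close> is
enough to ensure that the minimal weight is attained among these: the lower digits add less than
one unit of \<open>B\<^sup>n\<close>, so no exponent of larger degree can have a weight as small.\<close>

lemma lowest_exponent:
  fixes b :: "('n::finite \<Rightarrow> nat) \<Rightarrow> complex"
  assumes ord: "bij_betw ord (UNIV :: 'n set) {..<CARD('n)}"
    and B: "M < B" and \<beta>0: "b \<beta>0 \<noteq> 0" "sum \<beta>0 UNIV \<le> M"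
  obtains \<alpha> where "b \<alpha> \<noteq> 0" "sum \<alpha> UNIV \<le> M"
    "\<And>\<beta>. b \<beta> \<noteq> 0 \<Longrightarrow> \<beta> \<noteq> \<alpha> \<Longrightarrow>
      (\<Sum>i\<in>UNIV. lex_weight B ord i * \<alpha> i) < (\<Sum>i\<in>UNIV. lex_weight B ord i * \<beta> i)"
proof -
  define W where "W \<beta> = (\<Sum>i\<in>UNIV. lex_weight B ord i * \<beta> i)" for \<beta>
  define \<alpha> where "\<alpha> = arg_min W (\<lambda>\<beta>. b \<beta> \<noteq> 0)"
  have \<alpha>: "b \<alpha> \<noteq> 0" and min: "\<And>\<beta>. b \<beta> \<noteq> 0 \<Longrightarrow> W \<alpha> \<le> W \<beta>"
    unfolding \<alpha>_def using arg_min_nat_lemma[of "\<lambda>\<beta>. b \<beta> \<noteq> 0" \<beta>0 W] \<beta>0 by auto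
  have ordlt: "ord i < CARD('n)" for i
    using ord by (auto simp: bij_betw_def)
  have B0: "0 < B" using B by simp
  have W0: "W \<beta>0 < (M + 1) * B ^ CARD('n)"
  proof -
    have "(\<Sum>i\<in>UNIV. \<beta>0 i * B ^ ord i) \<le> (\<Sum>i\<in>UNIV. \<beta>0 i * B ^ (CARD('n) - 1))"
      using B0 ordlt by (intro sum_mono mult_left_mono power_increasing) (auto simp: Suc_leI le_diff_conv2)
    also have "\<dots> = sum \<beta>0 UNIV * B ^ (CARD('n) - 1)"
      by (simp add: sum_distrib_right)
    also have "\<dots> \<le> M * B ^ (CARD('n) - 1)"
      using \<beta>0 by simp
    also have "\<dots> < B * B ^ (CARD('n) - 1)"
      using B B0 by simp
    also have "\<dots> = B ^ CARD('n)"
      by (simp add: power_eq_if)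
    finally have "(\<Sum>i\<in>UNIV. \<beta>0 i * B ^ ord i) < B ^ CARD('n)" .
    moreover have "sum \<beta>0 UNIV * B ^ CARD('n) \<le> M * B ^ CARD('n)"
      by (intro mult_right_mono \<beta>0) auto
    ultimately show ?thesis
      unfolding W_def lex_weight_sum add_mult_distrib by linarith
  qed
  have deg: "sum \<beta> UNIV \<le> M" if "W \<beta> \<le> W \<beta>0" for \<beta>
  proof -
    have "sum \<beta> UNIV * B ^ CARD('n) \<le> W \<beta>"
      unfolding W_def lex_weight_sum by simp
    then have "sum \<beta> UNIV * B ^ CARD('n) < (M + 1) * B ^ CARD('n)"
      using that W0 by linarith
    then have "sum \<beta> UNIV < M + 1"
      by (metis mult_less_cancel2)
    then show ?thesis by simp
  qed
  have uniq: "\<beta> = \<gamma>" if eq: "W \<beta> = W \<gamma>" and le: "sum \<beta> UNIV \<le> M" "sum \<gamma> UNIV \<le> M" for \<beta> \<gamma>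
  proof -
    define coord where "coord = inv_into UNIV ord"
    have coord: "coord (ord i) = i" for i
      using ord by (simp add: coord_def bij_betw_def)
    have Wd: "W \<delta> = (\<Sum>k<CARD('n). \<delta> (coord k) * B ^ k) + sum \<delta> UNIV * B ^ CARD('n)" for \<delta>
      unfolding W_def lex_weight_sum
      using sum.reindex_bij_betw[OF ord, of "\<lambda>k. \<delta> (coord k) * B ^ k"] by (simp add: coord)
    have small: "\<delta> i < B" if "sum \<delta> UNIV \<le> M" for \<delta> :: "'n \<Rightarrow> nat" and i
      using member_le_sum[of i UNIV \<delta>] that B by simp
    have "\<forall>k<CARD('n). \<beta> (coord k) = \<gamma> (coord k)"
      using digits_unique[of "\<lambda>k. \<beta> (coord k)" B "CARD('n)" "sum \<beta> UNIV" "\<lambda>k. \<gamma> (coord k)" "sum \<gamma> UNIV"]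
        eq le small unfolding Wd by blast
    then show ?thesis
      using ordlt coord by (metis ext)
  qed
  show thesis
  proof
    show "b \<alpha> \<noteq> 0" by fact
    show "sum \<alpha> UNIV \<le> M" using deg min \<beta>0 by blast
    show "(\<Sum>i\<in>UNIV. lex_weight B ord i * \<alpha> i) < (\<Sum>i\<in>UNIV. lex_weight B ord i * \<beta> i)"
      if "b \<beta> \<noteq> 0" "\<beta> \<noteq> \<alpha>" for \<beta>
    proof (rule ccontr)
      assume "\<not> ?thesis"
      then have "W \<beta> = W \<alpha>" using min[OF that(1)] unfolding W_def by simp
      moreover from this have "W \<beta> \<le> W \<beta>0" "W \<alpha> \<le> W \<beta>0" using min \<beta>0 by auto
      ultimately show False using uniq deg that by blast
    qed
  qed
qed

text \<open>The \<open>i\<close>-th component of a map with triangular linear part contains \<open>x\<^sub>i\<close>, later variables, which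
have larger weight, and terms of degree at least two, whose weight is at least \<open>2 B\<^sup>n\<close>. So
\<open>x\<^sub>i\<close> alone has the smallest weight.\<close>

lemma triangular_map_leading_term:
  fixes f :: "complex ^ 'n \<Rightarrow> complex ^ 'n"
  assumes ord: "bij_betw ord (UNIV :: 'n set) {..<CARD('n)}" and B: "2 \<le> B"
    and f: "pseries r M b (\<lambda>x. f x $ i)" and r: "0 < r"
    and b0: "b (\<lambda>_. 0) = 0" and tri: "\<And>j. ord j < ord i \<Longrightarrow> b (unit_exp j) = 0"
  shows "((\<lambda>t. f (\<chi> k. of_real t ^ lex_weight B ord k) $ i / of_real t ^ lex_weight B ord i)
    \<longlongrightarrow> b (unit_exp i)) (at_right 0)"
proof -
  have ordlt: "ord i < CARD('n)" for i
    using ord by (auto simp: bij_betw_def)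
  have "lex_weight B ord i < (\<Sum>k\<in>UNIV. lex_weight B ord k * \<beta> k)"
    if nz: "b \<beta> \<noteq> 0" and ne: "\<beta> \<noteq> unit_exp i" for \<beta>
  proof (cases "sum \<beta> UNIV \<le> 1")
    case True
    then obtain j where j: "\<beta> = unit_exp j"
      using exponent_degree_le_1[of \<beta>] nz b0 by auto
    then have "i \<noteq> j" "\<not> ord j < ord i" using ne tri[of j] nz by auto
    moreover have "ord i \<noteq> ord j"
      using ord \<open>i \<noteq> j\<close> by (auto simp: bij_betw_def inj_def)
    ultimately have "ord i < ord j" by simp
    then show ?thesis
      using B by (simp add: j sum_unit_exp lex_weight_def power_strict_increasing)
  next
    case False
    then have "2 * B ^ CARD('n) \<le> sum \<beta> UNIV * B ^ CARD('n)"
      by (intro mult_right_mono) auto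
    moreover have "B ^ ord i < B ^ CARD('n)"
      using B ordlt by (intro power_strict_increasing) auto
    ultimately show ?thesis
      unfolding lex_weight_sum lex_weight_def[of B ord i] by linarith
  qed
  moreover have "1 \<le> lex_weight B ord k" for k
    using B one_le_power[of B "ord k"] by (simp add: lex_weight_def trans_le_add2)
  ultimately have "((\<lambda>t. f (\<chi> k. of_real t ^ lex_weight B ord k * (\<chi> k. 1) $ k) $ i
      / of_real t ^ lex_weight B ord i) \<longlongrightarrow> b (unit_exp i) * mpow (\<chi> k. 1) (unit_exp i)) (at_right 0)"
    by (intro pseries_leading_term[OF f r]) (auto simp: sum_unit_exp)
  then show ?thesis by simp
qed

text \<open>The linear coefficients of the conjugated map are identified with the entries of the triangular matrix by
uniqueness of the derivative at the origin.\<close>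

lemma conjugated_diffeo_leading_term:
  fixes f :: "complex ^ 'n \<Rightarrow> complex ^ 'n"
  assumes f: "local_analytic_diffeo f U"
    and ord: "bij_betw ord (UNIV :: 'n set) {..<CARD('n)}" and B: "2 \<le> B"
    and tri: "\<And>i j. ord j < ord i \<Longrightarrow> (Q ** jacobian f (at 0) ** P) $ i $ j = 0"
    and diag: "\<And>i. (Q ** jacobian f (at 0) ** P) $ i $ i = \<mu> $ i"
  shows "((\<lambda>t. (Q *v f (P *v (\<chi> k. of_real t ^ lex_weight B ord k))) $ i / of_real t ^ lex_weight B ord i)
    \<longlongrightarrow> \<mu> $ i) (at_right 0)"
proof -
  define T where "T = Q ** jacobian f (at 0) ** P"
  have "\<exists>r>0. \<exists>M b. pseries r M b (\<lambda>z. f (P *v z) $ j)" for j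
  proof -
    have "mv_analytic_on (\<lambda>x. f x $ j) U" "0 \<in> U"
      using f by (auto simp: local_analytic_diffeo_def mv_analytic_map_on_def)
    from analytic_imp_pseries[OF this] obtain r M b where
      "0 < r" "pseries r M b (\<lambda>x. f x $ j)" by auto
    from pseries_linear_substitution[OF this(2,1)] show ?thesis by blast
  qed
  then have "\<forall>k<CARD('n). \<exists>r>0. \<exists>M b. pseries r M b (\<lambda>z. f (P *v z) $ inv_into UNIV ord k)"
    by blast
  then obtain r where r: "0 < r" "\<forall>k<CARD('n). \<exists>M b. pseries r M b (\<lambda>z. f (P *v z) $ inv_into UNIV ord k)"
    using pseries_common_radius[of "CARD('n)" "\<lambda>k z. f (P *v z) $ inv_into UNIV ord k"] by blast
  have "\<exists>M b. pseries r M b (\<lambda>z. f (P *v z) $ j)" for j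
  proof -
    have "ord j < CARD('n)" "inv_into UNIV ord (ord j) = j"
      using ord by (auto simp: bij_betw_def)
    then show ?thesis using r(2) by metis
  qed
  then obtain M b where "\<And>j. pseries r (M j) (b j) (\<lambda>z. f (P *v z) $ j)" by metis
  then have "pseries r (\<Sum>j\<in>UNIV. norm (Q $ i $ j) * M j) (\<lambda>\<alpha>. \<Sum>j\<in>UNIV. Q $ i $ j * b j \<alpha>)
      (\<lambda>z. \<Sum>j\<in>UNIV. Q $ i $ j * f (P *v z) $ j)"
    by (intro pseries_finite_sum[OF r(1)] pseries_cmult) auto
  then obtain L c where c: "pseries r L c (\<lambda>z. (Q *v f (P *v z)) $ i)"
    unfolding matrix_vector_mult_def by simp
  have lin: "((\<lambda>x. X *v x) has_derivative (\<lambda>h. X *v h)) (at z)" for X :: "complex ^ 'n ^ 'n" and z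
    by (rule bounded_linear_imp_has_derivative) simp
  have "((\<lambda>z. f (P *v z)) has_derivative (\<lambda>h. jacobian f (at 0) *v (P *v h))) (at 0)"
    by (rule has_derivative_compose[OF lin]) (simp add: analytic_diffeo_derivative[OF f])
  from has_derivative_compose[OF this lin]
  have "((\<lambda>z. Q *v f (P *v z)) has_derivative (\<lambda>h. T *v h)) (at 0)"
    by (simp add: T_def matrix_vector_mul_assoc matrix_mul_assoc)
  from bounded_linear.has_derivative[OF bounded_linear_vec_nth this]
  have "((\<lambda>z. (Q *v f (P *v z)) $ i) has_derivative (\<lambda>h. (T *v h) $ i)) (at 0)" .
  then have eq: "(\<lambda>h. (T *v h) $ i) = (\<lambda>h. \<Sum>j\<in>UNIV. c (unit_exp j) * h $ j)"
    using pseries_has_derivative[OF c r(1)] by (rule has_derivative_unique)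
  have cT: "c (unit_exp j) = T $ i $ j" for j
    using fun_cong[OF eq, of "axis j 1"]
    by (simp add: matrix_vector_mult_def axis_def if_distrib[of "\<lambda>z. _ * z"] cong: if_cong)
  have "f 0 = 0" using f by (simp add: local_analytic_diffeo_def)
  then have "c (\<lambda>_. 0) = 0" using pseries_at_0[OF c r(1)] by simp
  then have "((\<lambda>t. (Q *v f (P *v (\<chi> k. of_real t ^ lex_weight B ord k))) $ i
      / of_real t ^ lex_weight B ord i) \<longlongrightarrow> c (unit_exp i)) (at_right 0)"
    using triangular_map_leading_term[OF ord B, of r L c "\<lambda>z. Q *v f (P *v z)" i] c r(1) tri
    by (simp add: cT T_def)
  then show ?thesis by (simp add: cT T_def diag)
qed

text \<open>Along \<open>x(t) = (t\<^bsup>w i\<^esup>)\<^sub>i\<close> the map acts like the diagonal matrix with entries \<open>\<mu>\<^sub>i\<close>: here \<open>P (x t)\<close>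
behaves like \<open>p\<^sub>\<alpha> t\<^bsup>w\<cdot>\<alpha>\<^esup>\<close> and \<open>P (f (x t))\<close> like \<open>p\<^sub>\<alpha> \<mu>\<^sup>\<alpha> t\<^bsup>w\<cdot>\<alpha>\<^esup>\<close>, and similarly for \<open>Q\<close>. Comparing the two sides
of the invariance yields \<open>p\<^sub>\<alpha> \<mu>\<^sup>\<alpha> q\<^sub>\<beta> = p\<^sub>\<alpha> q\<^sub>\<beta> \<mu>\<^sup>\<beta>\<close>.\<close>

lemma leading_exponents_resonant:
  fixes f :: "complex ^ 'n \<Rightarrow> complex ^ 'n"
  assumes P: "pseries r M p P" and Q: "pseries r N q Q" and r: "0 < r"
    and w: "\<And>i. 1 \<le> w i"
    and f: "\<And>i. ((\<lambda>t. f (\<chi> k. of_real t ^ w k) $ i / of_real t ^ w i) \<longlongrightarrow> \<mu> $ i) (at_right 0)"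
    and inv: "\<forall>\<^sub>F x in nhds 0. P (f x) * Q x = P x * Q (f x)"
    and \<alpha>: "p \<alpha> \<noteq> 0" "\<And>\<gamma>. p \<gamma> \<noteq> 0 \<Longrightarrow> \<gamma> \<noteq> \<alpha> \<Longrightarrow>
      (\<Sum>i\<in>UNIV. w i * \<alpha> i) < (\<Sum>i\<in>UNIV. w i * \<gamma> i)"
    and \<beta>: "q \<beta> \<noteq> 0" "\<And>\<gamma>. q \<gamma> \<noteq> 0 \<Longrightarrow> \<gamma> \<noteq> \<beta> \<Longrightarrow>
      (\<Sum>i\<in>UNIV. w i * \<beta> i) < (\<Sum>i\<in>UNIV. w i * \<gamma> i)"
  shows "mpow \<mu> \<alpha> = mpow \<mu> \<beta>"
proof -
  define x :: "real \<Rightarrow> complex ^ 'n" where "x t = (\<chi> k. of_real t ^ w k)" for t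
  define d where "d = (\<Sum>i\<in>UNIV. w i * \<alpha> i)"
  define e where "e = (\<Sum>i\<in>UNIV. w i * \<beta> i)"
  define y where "y t = (\<chi> i. f (x t) $ i / of_real t ^ w i)" for t
  have yl: "((\<lambda>t. y t $ i) \<longlongrightarrow> \<mu> $ i) (at_right 0)" for i
    using f by (simp add: y_def x_def)
  have xy: "(\<chi> i. of_real t ^ w i * y t $ i) = f (x t)" if "t \<noteq> 0" for t
    using that by (simp add: y_def vec_eq_iff)
  have ev0: "\<forall>\<^sub>F t in at_right (0::real). t \<noteq> 0"
    by (simp add: eventually_at_filter)
  have one: "((\<lambda>t. ((\<chi> i. 1) :: complex ^ 'n) $ i) \<longlongrightarrow>
      ((\<chi> i. 1) :: complex ^ 'n) $ i) (at_right (0::real))" for i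
    by simp
  have mone: "mpow (\<chi> i. 1) \<gamma> = 1" for \<gamma> :: "'n \<Rightarrow> nat"
    by (simp add: mpow_def)
  have lead: "((\<lambda>t. S (x t) / of_real t ^ k) \<longlongrightarrow> s \<gamma>) (at_right 0)"
    "((\<lambda>t. S (f (x t)) / of_real t ^ k) \<longlongrightarrow> s \<gamma> * mpow \<mu> \<gamma>) (at_right 0)"
    if S: "pseries r L s S" and k: "k = (\<Sum>i\<in>UNIV. w i * \<gamma> i)"
      and l: "\<And>\<delta>. s \<delta> \<noteq> 0 \<Longrightarrow> \<delta> \<noteq> \<gamma> \<Longrightarrow> (\<Sum>i\<in>UNIV. w i * \<gamma> i) < (\<Sum>i\<in>UNIV. w i * \<delta> i)"
    for S s L k \<gamma>
  proof -
    show "((\<lambda>t. S (x t) / of_real t ^ k) \<longlongrightarrow> s \<gamma>) (at_right 0)"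
      using pseries_leading_term[OF S r w k _ one] l k by (simp add: x_def mone)
    have "((\<lambda>t. S (\<chi> i. of_real t ^ w i * y t $ i) / of_real t ^ k) \<longlongrightarrow> s \<gamma> * mpow \<mu> \<gamma>) (at_right 0)"
      using pseries_leading_term[OF S r w k _ yl] l k by simp
    then show "((\<lambda>t. S (f (x t)) / of_real t ^ k) \<longlongrightarrow> s \<gamma> * mpow \<mu> \<gamma>) (at_right 0)"
      by (rule Lim_transform_eventually) (use ev0 in \<open>eventually_elim, simp add: xy\<close>)
  qed
  have "(x \<longlongrightarrow> 0) (at_right 0)"
  proof (rule vec_tendstoI)
    fix i
    have "((\<lambda>t. complex_of_real t ^ w i) \<longlongrightarrow> of_real 0 ^ w i) (at_right 0)"
      by (intro tendsto_intros)
    moreover have "w i \<noteq> 0" using w[of i] by simp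
    ultimately show "((\<lambda>t. x t $ i) \<longlongrightarrow> 0 $ i) (at_right 0)"
      by (simp add: x_def power_0_left)
  qed
  then have evinv: "\<forall>\<^sub>F t in at_right 0. P (f (x t)) * Q (x t) = P (x t) * Q (f (x t))"
    by (rule eventually_compose_filterlim[OF inv])
  have L1: "((\<lambda>t. (P (f (x t)) / of_real t ^ d) * (Q (x t) / of_real t ^ e))
      \<longlongrightarrow> (p \<alpha> * mpow \<mu> \<alpha>) * q \<beta>) (at_right 0)"
    by (intro tendsto_mult lead(2)[OF P] lead(1)[OF Q]) (use \<alpha> \<beta> d_def e_def in auto)
  have L2: "((\<lambda>t. (P (x t) / of_real t ^ d) * (Q (f (x t)) / of_real t ^ e))
      \<longlongrightarrow> p \<alpha> * (q \<beta> * mpow \<mu> \<beta>)) (at_right 0)"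
    by (intro tendsto_mult lead(1)[OF P] lead(2)[OF Q]) (use \<alpha> \<beta> d_def e_def in auto)
  have "((\<lambda>t. (P (f (x t)) / of_real t ^ d) * (Q (x t) / of_real t ^ e))
      \<longlongrightarrow> p \<alpha> * (q \<beta> * mpow \<mu> \<beta>)) (at_right 0)"
    by (rule Lim_transform_eventually[OF L2]) (use evinv in \<open>eventually_elim, simp\<close>)
  then have "(p \<alpha> * mpow \<mu> \<alpha>) * q \<beta> = p \<alpha> * (q \<beta> * mpow \<mu> \<beta>)"
    using tendsto_unique[OF _ L1] by simp
  then show ?thesis using \<alpha> \<beta> by simp
qed

section \<open>Linear systems and coefficients of polynomials\<close>

text \<open>Gaussian elimination: one equation is solved for an unknown \<open>u\<close> with nonzero coefficient, and \<open>u\<close> is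
substituted into the others.\<close>

lemma homogeneous_system_nontrivial_solution:
  fixes c :: "'e \<Rightarrow> 'v \<Rightarrow> 'a :: field"
  assumes "finite E" "finite V" "card E < card V"
  shows "\<exists>x. (\<exists>v\<in>V. x v \<noteq> 0) \<and> (\<forall>e\<in>E. (\<Sum>v\<in>V. x v * c e v) = 0)"
  using assms
proof (induction E arbitrary: V c rule: finite_induct)
  case empty
  then obtain v where "v \<in> V" by (metis card.empty all_not_in_conv less_irrefl)
  then show ?case by (intro exI[of _ "\<lambda>_. 1"]) auto
next
  case (insert e E)
  show ?case
  proof (cases "\<forall>v\<in>V. c e v = 0")
    case True
    have "card E < card V" using insert by simp
    from insert.IH[OF \<open>finite V\<close> this, of c] True show ?thesis by auto
  next
    case False
    then obtain u where u: "u \<in> V" "c e u \<noteq> 0" by blast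
    define V' where "V' = V - {u}"
    have V: "finite V'" "u \<notin> V'" "V = insert u V'" using insert.prems u by (auto simp: V'_def)
    have "card E < card V'" using insert V by simp
    from insert.IH[OF V(1) this, of "\<lambda>e' v. c e' v - c e' u * c e v / c e u"]
    obtain x where x: "\<exists>v\<in>V'. x v \<noteq> 0"
      "\<And>e'. e' \<in> E \<Longrightarrow> (\<Sum>v\<in>V'. x v * (c e' v - c e' u * c e v / c e u)) = 0"
      by blast
    \<comment> \<open>the value that the eliminated equation \<open>e\<close> forces upon the unknown \<open>u\<close>\<close>
    define xu where "xu = - (\<Sum>v\<in>V'. x v * c e v) / c e u"
    define y where "y = x(u := xu)"
    have sumy: "(\<Sum>v\<in>V. y v * c e' v) = xu * c e' u + (\<Sum>v\<in>V'. x v * c e' v)" for e'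
    proof -
      have "(\<Sum>v\<in>V'. y v * c e' v) = (\<Sum>v\<in>V'. x v * c e' v)"
        by (intro sum.cong) (use V in \<open>auto simp: y_def\<close>)
      then show ?thesis using V by (simp add: y_def)
    qed
    have "(\<Sum>v\<in>V. y v * c e v) = 0"
      unfolding sumy xu_def using u by simp
    moreover have "(\<Sum>v\<in>V. y v * c e' v) = 0" if "e' \<in> E" for e'
    proof -
      have "0 = (\<Sum>v\<in>V'. x v * c e' v) - (\<Sum>v\<in>V'. x v * c e v) * c e' u / c e u"
        using x(2)[OF that]
        by (simp add: algebra_simps sum_subtractf sum_distrib_left sum_divide_distrib)
      then show ?thesis
        unfolding sumy xu_def by (simp add: field_simps)
    qed
    moreover have "\<exists>v\<in>V. y v \<noteq> 0" using x(1) V by (auto simp: y_def)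
    ultimately show ?thesis by auto
  qed
qed

lemma sum_powers_root_of_unity:
  fixes x :: complex
  assumes "x ^ L = 1" "x \<noteq> 1"
  shows "(\<Sum>k<L. x ^ k) = 0"
  using assms by (simp add: geometric_sum)

lemma root_of_unity_orthogonality:
  fixes a b L :: nat
  assumes "a < L" "b < L"
  shows "(\<Sum>k<L. cis (2 * pi * k * b / L) * cis (- (2 * pi * k * a / L))) = (if a = b then of_nat L else 0)"
proof -
  define x where "x = cis (2 * pi * (real b - real a) / L)"
  have "cis (2 * pi * k * b / L) * cis (- (2 * pi * k * a / L)) = x ^ k" for k :: nat
    by (simp add: x_def cis_mult Complex.DeMoivre algebra_simps diff_divide_distrib)
  then have s: "(\<Sum>k<L. cis (2 * pi * k * b / L) * cis (- (2 * pi * k * a / L))) = (\<Sum>k<L. x ^ k)"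
    by simp
  show ?thesis
  proof (cases "a = b")
    case True
    then show ?thesis unfolding s by (simp add: x_def)
  next
    case False
    have L: "0 < real L" using assms by simp
    have "x ^ L = cis (2 * pi * (real b - real a))"
      using L by (simp add: x_def Complex.DeMoivre)
    also have "\<dots> = 1"
      using cis_multiple_2pi[of "real b - real a"] by (simp add: algebra_simps)
    finally have "x ^ L = 1" .
    moreover have "x \<noteq> 1"
    proof
      assume "x = 1"
      then have "cos (2 * pi * (real b - real a) / L) = 1"
        unfolding x_def by (metis cis.sel(1) one_complex.sel(1))
      then obtain k :: int where "2 * pi * (real b - real a) / L = of_int k * 2 * pi"
        using cos_one_2pi_int by auto
      then have "2 * pi * ((real b - real a) / L - of_int k) = 0"
        by (simp add: algebra_simps)
      then have "(real b - real a) / L - of_int k = 0"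
        by simp
      then have "real b - real a = of_int k * real L"
        using L by (simp add: field_simps)
      then have "of_int (int b - int a) = (of_int (k * int L) :: real)" by simp
      then have eq: "int b - int a = k * int L" using of_int_eq_iff by blast
      then have "int L dvd int b - int a" by simp
      moreover have "\<bar>int b - int a\<bar> < int L" using assms by linarith
      ultimately show False using False by (metis zdvd_not_zless zdvd_imp_le abs_dvd_iff dvd_abs_iff diff_eq_eq add_0 of_nat_eq_iff zero_less_abs_iff right_minus_eq)
    qed
    ultimately show ?thesis
      unfolding s using sum_powers_root_of_unity False by simp
  qed
qed

text \<open>The coefficients are discrete Fourier averages of the values at tuples of \<open>(N+1)\<close>-st roots of unity;
as all degrees are at most \<open>N\<close>, distinct exponents are orthogonal on this grid.\<close>

lemma polynomial_coefficient_bound: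
  fixes c :: "('i \<Rightarrow> nat) \<Rightarrow> complex"
  assumes I: "finite I" and a: "a \<in> I \<rightarrow>\<^sub>E {..N}"
    and bound: "\<And>z. (\<And>i. norm (z i) = 1) \<Longrightarrow>
      norm (\<Sum>b\<in>I \<rightarrow>\<^sub>E {..N}. c b * (\<Prod>i\<in>I. z i ^ b i)) \<le> \<epsilon>"
  shows "norm (c a) \<le> \<epsilon>"
proof -
  define L where "L = Suc N"
  define Z where "Z = I \<rightarrow>\<^sub>E {..<L}"
  define \<zeta> where "\<zeta> k = (\<lambda>i. cis (2 * pi * k i / L))" for k :: "'i \<Rightarrow> nat"
  define \<eta> where "\<eta> k = (\<Prod>i\<in>I. cis (- (2 * pi * k i * a i / L)))" for k :: "'i \<Rightarrow> nat"
  have finA: "finite (I \<rightarrow>\<^sub>E {..N})" using I by (simp add: finite_PiE)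
  have cardZ: "card Z = L ^ card I" using I by (simp add: Z_def card_PiE)
  have orth: "(\<Sum>k\<in>Z. (\<Prod>i\<in>I. \<zeta> k i ^ b i) * \<eta> k) = (if a = b then of_nat L ^ card I else 0)"
    if b: "b \<in> I \<rightarrow>\<^sub>E {..N}" for b
  proof -
    have "(\<Sum>k\<in>Z. (\<Prod>i\<in>I. \<zeta> k i ^ b i) * \<eta> k)
        = (\<Sum>k\<in>Z. \<Prod>i\<in>I. cis (2 * pi * k i * b i / L) * cis (- (2 * pi * k i * a i / L)))"
    proof -
      have "\<zeta> k i ^ b i = cis (2 * pi * k i * b i / L)" for k i
        unfolding \<zeta>_def Complex.DeMoivre by (simp add: mult_ac)
      then show ?thesis by (simp add: \<eta>_def prod.distrib)
    qed
    also have "\<dots> = (\<Prod>i\<in>I. \<Sum>j<L. cis (2 * pi * j * b i / L) * cis (- (2 * pi * j * a i / L)))"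
      unfolding Z_def using I by (subst prod_sum_PiE) auto
    also have "\<dots> = (\<Prod>i\<in>I. if a i = b i then of_nat L else 0)"
    proof (intro prod.cong refl)
      fix i assume "i \<in> I"
      then have "a i < L" "b i < L" using a b by (auto simp: L_def PiE_iff less_Suc_eq_le)
      then show "(\<Sum>j<L. cis (2 * pi * j * b i / L) * cis (- (2 * pi * j * a i / L)))
          = (if a i = b i then of_nat L else 0)"
        by (rule root_of_unity_orthogonality)
    qed
    also have "\<dots> = (if a = b then of_nat L ^ card I else 0)"
    proof (cases "a = b")
      case False
      then obtain i where "i \<in> I" "a i \<noteq> b i" using a b by (metis PiE_ext)
      then show ?thesis using I False by (auto intro: prod_zero)
    qed auto
    finally show ?thesis .
  qed
  have "(\<Sum>k\<in>Z. (\<Sum>b\<in>I \<rightarrow>\<^sub>E {..N}. c b * (\<Prod>i\<in>I. \<zeta> k i ^ b i)) * \<eta> k)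
      = (\<Sum>b\<in>I \<rightarrow>\<^sub>E {..N}. c b * (\<Sum>k\<in>Z. (\<Prod>i\<in>I. \<zeta> k i ^ b i) * \<eta> k))"
    by (subst sum_distrib_right, subst sum.swap) (simp add: sum_distrib_left mult.assoc)
  also have "\<dots> = (\<Sum>b\<in>I \<rightarrow>\<^sub>E {..N}. if a = b then c b * of_nat L ^ card I else 0)"
    by (intro sum.cong) (auto simp: orth)
  also have "\<dots> = c a * of_nat L ^ card I"
    using finA a by simp
  finally have "norm (c a) * real L ^ card I
      = norm (\<Sum>k\<in>Z. (\<Sum>b\<in>I \<rightarrow>\<^sub>E {..N}. c b * (\<Prod>i\<in>I. \<zeta> k i ^ b i)) * \<eta> k)"
    by (simp add: norm_mult norm_power)
  also have "\<dots> \<le> (\<Sum>k\<in>Z. \<epsilon>)"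
  proof (rule sum_norm_le)
    fix k
    have "norm (\<eta> k) = 1" by (simp add: \<eta>_def flip: prod_norm)
    then show "norm ((\<Sum>b\<in>I \<rightarrow>\<^sub>E {..N}. c b * (\<Prod>i\<in>I. \<zeta> k i ^ b i)) * \<eta> k) \<le> \<epsilon>"
      using bound[of "\<zeta> k"] by (simp add: norm_mult \<zeta>_def)
  qed
  also have "\<dots> = \<epsilon> * real L ^ card I"
    using cardZ by simp
  finally show ?thesis by (simp add: L_def)
qed

section \<open>Exponents in a resonance class\<close>

lemma common_denominator:
  fixes x :: "'v \<Rightarrow> rat"
  assumes "finite B"
  shows "\<exists>D>0. \<exists>y. \<forall>v\<in>B. rat_of_int (y v) = of_int D * x v"
  using assms
proof (induction B rule: finite_induct)
  case empty
  show ?case by (intro exI[of _ 1]) auto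
next
  case (insert u B)
  then obtain D y where D: "0 < D" "\<forall>v\<in>B. rat_of_int (y v) = of_int D * x v" by auto
  obtain p q where pq: "quotient_of (x u) = (p, q)" by (cases "quotient_of (x u)")
  have q: "0 < q" "x u = of_int p / of_int q"
    using quotient_of_denom_pos[OF pq] quotient_of_div[OF pq] by auto
  define y' where "y' v = (if v = u then D * p else q * y v)" for v
  have "\<forall>v\<in>insert u B. rat_of_int (y' v) = of_int (D * q) * x v"
    using D q by (auto simp: y'_def)
  moreover have "0 < D * q" using D q by simp
  ultimately show ?case by blast
qed

text \<open>More than \<open>n\<close> vectors in \<open>\<int>\<^sup>n\<close> satisfy a rational relation, and clearing denominators makes it an integral one. This
bound is what makes the maximum in \<open>int_span_rank\<close> meaningful.\<close>

lemma card_int_independent_le: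
  fixes B :: "(int ^ 'n) set"
  assumes "int_vec.independent B"
  shows "card B \<le> CARD('n)"
proof (rule ccontr)
  assume big: "\<not> card B \<le> CARD('n)"
  then have fin: "finite B" by (metis card.infinite le0)
  obtain x where x: "\<exists>v\<in>B. x v \<noteq> 0" "\<forall>e::'n. (\<Sum>v\<in>B. x v * rat_of_int (v $ e)) = 0"
    using homogeneous_system_nontrivial_solution[of "UNIV :: 'n set" B "\<lambda>e v. rat_of_int (v $ e)"] fin big
    by auto
  obtain D y where D: "0 < D" "\<forall>v\<in>B. rat_of_int (y v) = of_int D * x v"
    using common_denominator[OF fin, of x] by blast
  have "(\<Sum>v\<in>B. y v *s v) = 0"
  proof (simp add: vec_eq_iff, intro allI)
    fix e
    have "rat_of_int (\<Sum>v\<in>B. y v * v $ e) = of_int D * (\<Sum>v\<in>B. x v * rat_of_int (v $ e))"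
      using D(2) by (simp add: sum_distrib_left mult.assoc)
    then show "(\<Sum>v\<in>B. y v * v $ e) = 0" using x(2) by (metis mult_zero_right of_int_eq_0_iff)
  qed
  moreover have "\<exists>v\<in>B. y v \<noteq> 0"
    using x(1) D by (metis less_irrefl mult_eq_0_iff of_int_0 of_int_eq_0_iff)
  ultimately have "int_vec.dependent B"
    using int_vec.dependent_finite[OF fin] by blast
  then show False using assms by simp
qed

lemma card_le_int_span_rank:
  fixes B :: "(int ^ 'n) set"
  assumes "B \<subseteq> int_vec.span K" "int_vec.independent B"
  shows "card B \<le> int_span_rank K"
  unfolding int_span_rank_def
proof (rule Max_ge)
  have "{card B | B. B \<subseteq> int_vec.span K \<and> int_vec.independent B} \<subseteq> {..CARD('n)}"
    using card_int_independent_le by auto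
  then show "finite {card B | B. B \<subseteq> int_vec.span K \<and> int_vec.independent B}"
    using finite_subset by blast
qed (use assms in blast)

text \<open>Take a set \<open>I\<close> of coordinates of least cardinality on which no nonzero element of \<open>K\<close> vanishes. By
minimality, each \<open>i\<close> in \<open>I\<close> has an element of \<open>K\<close> that is nonzero at \<open>i\<close> and vanishes at the rest
of \<open>I\<close>. These elements form a diagonal matrix on \<open>I\<close>, so they are independent over \<open>\<int>\<close>.\<close>

lemma determining_coordinates:
  fixes K :: "(int ^ 'n) set"
  obtains I :: "'n set" where "card I \<le> int_span_rank K"
    "\<And>k. k \<in> K \<Longrightarrow> (\<And>i. i \<in> I \<Longrightarrow> k $ i = 0) \<Longrightarrow> k = 0"
proof -
  define det where "det I \<longleftrightarrow> (\<forall>k\<in>K. (\<forall>i\<in>I. k $ i = 0) \<longrightarrow> k = 0)" for I :: "'n set"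
  have "det UNIV" by (auto simp: det_def vec_eq_iff)
  then obtain I where I: "det I" and min: "\<And>J. det J \<Longrightarrow> card I \<le> card J"
    using arg_min_nat_lemma[of det UNIV card] by blast
  have "\<exists>k\<in>K. k $ i \<noteq> 0 \<and> (\<forall>j\<in>I - {i}. k $ j = 0)" if i: "i \<in> I" for i
  proof -
    have "card (I - {i}) < card I" using i by (intro psubset_card_mono) auto
    then have "\<not> det (I - {i})" using min by fastforce
    then obtain k where k: "k \<in> K" "\<forall>j\<in>I - {i}. k $ j = 0" "k \<noteq> 0"
      by (auto simp: det_def)
    moreover have "k $ i \<noteq> 0"
      using k I unfolding det_def by blast
    ultimately show ?thesis by blast
  qed
  then obtain v where v: "\<And>i. i \<in> I \<Longrightarrow> v i \<in> K" "\<And>i. i \<in> I \<Longrightarrow> v i $ i \<noteq> 0"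
    "\<And>i j. i \<in> I \<Longrightarrow> j \<in> I \<Longrightarrow> j \<noteq> i \<Longrightarrow> v i $ j = 0"
    by (metis DiffI empty_iff insert_iff)
  have inj: "inj_on v I"
    using v(2,3) by (metis inj_onI)
  have "int_vec.independent (v ` I)"
  proof
    assume "int_vec.dependent (v ` I)"
    then obtain u i where u: "(\<Sum>x\<in>v ` I. u x *s x) = 0" and i: "i \<in> I" "u (v i) \<noteq> 0"
      using int_vec.dependent_finite[of "v ` I"] by auto
    have "0 = (\<Sum>x\<in>v ` I. u x *s x) $ i"
      using u by simp
    also have "\<dots> = (\<Sum>j\<in>I. u (v j) * v j $ i)"
      by (simp add: sum.reindex[OF inj])
    also have "\<dots> = (\<Sum>j\<in>I. if j = i then u (v i) * v i $ i else 0)"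
      by (intro sum.cong) (use v(3) i in auto)
    also have "\<dots> = u (v i) * v i $ i" using i by simp
    finally show False using v(2) i by simp
  qed
  moreover have "v ` I \<subseteq> int_vec.span K"
    using v(1) int_vec.span_base by blast
  ultimately have "card I \<le> int_span_rank K"
    using card_le_int_span_rank[of "v ` I"] by (simp add: card_image[OF inj])
  then show thesis
    using that I unfolding det_def by blast
qed

text \<open>The difference of two exponents in the class is resonant, so exponents that agree on \<open>I\<close> are equal.\<close>

lemma card_resonance_class_le:
  fixes \<mu> :: "complex ^ 'n"
  assumes nz: "\<And>i. \<mu> $ i \<noteq> 0"
    and I: "\<And>k. mv_powi \<mu> k = 1 \<Longrightarrow> (\<And>i. i \<in> I \<Longrightarrow> k $ i = 0) \<Longrightarrow> k = 0"
  shows "finite {\<alpha>. sum \<alpha> UNIV \<le> M \<and> mpow \<mu> \<alpha> = l}"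
    "card {\<alpha>. sum \<alpha> UNIV \<le> M \<and> mpow \<mu> \<alpha> = l} \<le> (M + 1) ^ card I"
proof -
  define A where "A = {\<alpha>. sum \<alpha> UNIV \<le> M \<and> mpow \<mu> \<alpha> = l}"
  have inj: "inj_on (\<lambda>\<alpha>. restrict \<alpha> I) A"
  proof (rule inj_onI)
    fix \<alpha> \<beta> assume "\<alpha> \<in> A" "\<beta> \<in> A" and eq: "restrict \<alpha> I = restrict \<beta> I"
    then have mp: "mpow \<mu> \<alpha> = mpow \<mu> \<beta>" by (simp add: A_def)
    define k :: "int ^ 'n" where "k = (\<chi> i. int (\<alpha> i) - int (\<beta> i))"
    have "mv_powi \<mu> k = mpow \<mu> \<alpha> / mpow \<mu> \<beta>"
      by (simp add: mv_powi_def mpow_def k_def power_int_diff nz prod_dividef)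
    also have "\<dots> = 1"
      unfolding mp by (simp add: mpow_def nz)
    finally have "mv_powi \<mu> k = 1" .
    moreover have "k $ i = 0" if "i \<in> I" for i
      using fun_cong[OF eq, of i] that by (simp add: k_def)
    ultimately have "k = 0" by (rule I)
    then show "\<alpha> = \<beta>" by (auto simp: k_def vec_eq_iff)
  qed
  have sub: "(\<lambda>\<alpha>. restrict \<alpha> I) ` A \<subseteq> I \<rightarrow>\<^sub>E {..M}"
  proof (rule image_subsetI, rule PiE_I)
    fix \<alpha> i assume \<alpha>: "\<alpha> \<in> A" and i: "i \<in> I"
    have "\<alpha> i \<le> sum \<alpha> UNIV" by (rule member_le_sum) auto
    then show "restrict \<alpha> I i \<in> {..M}" using \<alpha> i by (auto simp: A_def)
  qed auto
  have finE: "finite (I \<rightarrow>\<^sub>E {..M})" by (simp add: finite_PiE)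
  show "finite {\<alpha>. sum \<alpha> UNIV \<le> M \<and> mpow \<mu> \<alpha> = l}"
    using finite_imageD[OF finite_subset[OF sub finE] inj] by (simp add: A_def)
  have "card A = card ((\<lambda>\<alpha>. restrict \<alpha> I) ` A)"
    by (simp add: card_image[OF inj])
  also have "\<dots> \<le> card (I \<rightarrow>\<^sub>E {..M})"
    by (rule card_mono[OF finE sub])
  also have "\<dots> = (M + 1) ^ card I"
    by (simp add: card_PiE)
  finally show "card {\<alpha>. sum \<alpha> UNIV \<le> M \<and> mpow \<mu> \<alpha> = l} \<le> (M + 1) ^ card I"
    by (simp add: A_def)
qed

section \<open>The image of independent functions\<close>

text \<open>The functions are completed by linear forms to a map \<open>\<Psi>\<close> of \<open>\<complex>\<^sup>n\<close> to itself with invertible derivative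
at \<open>x0\<close>. By Sussmann's open mapping theorem \<open>\<Psi> x0\<close> is an interior point of the image.\<close>

lemma independent_gradients_image:
  fixes R :: "nat \<Rightarrow> complex ^ 'n \<Rightarrow> complex" and \<gamma> :: "nat \<Rightarrow> complex ^ 'n"
  assumes S: "open S" "x0 \<in> S"
    and cont: "\<And>i. i < m \<Longrightarrow> continuous_on S (R i)"
    and der: "\<And>i. i < m \<Longrightarrow> (R i has_derivative (\<lambda>h. \<Sum>j\<in>UNIV. \<gamma> i $ j * h $ j)) (at x0)"
    and inj: "inj_on \<gamma> {..<m}" and ind: "vec.independent (\<gamma> ` {..<m})"
  obtains s where "0 < s"
    "\<And>z. (\<And>i. i < m \<Longrightarrow> norm (z i - R i x0) \<le> s) \<Longrightarrow> \<exists>x\<in>S. \<forall>i<m. R i x = z i"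
proof -
  obtain Bs where Bs: "\<gamma> ` {..<m} \<subseteq> Bs" "vec.independent Bs" "UNIV \<subseteq> vec.span Bs"
    using vec.maximal_independent_subset_extend[OF subset_UNIV ind] by auto
  have finBs: "finite Bs" using Bs(2) by (rule vec.finiteI_independent)
  have "card Bs = CARD('n)"
    using vec.basis_card_eq_dim[OF subset_UNIV Bs(3,2)] by (simp only: vec_dim_card)
  then obtain \<sigma> where \<sigma>: "bij_betw \<sigma> (UNIV :: 'n set) Bs"
    using finite_same_card_bij[of "UNIV :: 'n set" Bs] finBs by auto
  have inj\<sigma>: "inj \<sigma>" and ran\<sigma>: "range \<sigma> = Bs" using \<sigma> by (auto simp: bij_betw_def)
  define V where "V = (\<chi> j. \<sigma> j)"
  have "\<exists>V'. V ** V' = mat 1"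
    unfolding matrix_right_invertible_independent_rows
  proof (intro allI impI)
    fix c i assume c: "(\<Sum>i\<in>UNIV. c i *s row i V) = 0"
    have "(\<Sum>v\<in>Bs. c (inv_into UNIV \<sigma> v) *s v) = (\<Sum>i\<in>UNIV. c i *s \<sigma> i)"
      unfolding ran\<sigma>[symmetric] by (simp add: sum.reindex[OF inj\<sigma>] inv_f_f[OF inj\<sigma>])
    also have "\<dots> = 0"
      using c by (simp add: row_def V_def vec_lambda_eta)
    finally have "\<forall>v\<in>Bs. c (inv_into UNIV \<sigma> v) = 0"
      using Bs(2) vec.dependent_finite[OF finBs] by (metis (no_types))
    then show "c i = 0" using ran\<sigma> inj\<sigma> by (metis inv_f_f rangeI)
  qed
  then obtain V' where V': "V ** V' = mat 1" by blast
  define J where "J = {j. \<sigma> j \<in> \<gamma> ` {..<m}}"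
  define idx where "idx j = inv_into {..<m} \<gamma> (\<sigma> j)" for j
  have idx: "idx j < m" "\<gamma> (idx j) = \<sigma> j" if "j \<in> J" for j
    using that inv_into_into[of "\<sigma> j" \<gamma> "{..<m}"] f_inv_into_f[of "\<sigma> j" \<gamma> "{..<m}"]
    by (auto simp: J_def idx_def)
  define \<Psi> where "\<Psi> x = (\<chi> j. if j \<in> J then R (idx j) x else (\<Sum>k\<in>UNIV. \<sigma> j $ k * x $ k))" for x
  have lin: "((\<lambda>x. \<Sum>k\<in>UNIV. \<sigma> j $ k * x $ k) has_derivative (\<lambda>h. \<Sum>k\<in>UNIV. \<sigma> j $ k * h $ k)) (at x0)" for j
    by (intro bounded_linear_imp_has_derivative bounded_linear_sum bounded_linear_const_mult
        bounded_linear_vec_nth)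
  have d\<Psi>: "(\<Psi> has_derivative (\<lambda>h. \<chi> j. \<Sum>k\<in>UNIV. \<sigma> j $ k * h $ k)) (at x0)"
    unfolding \<Psi>_def
  proof (rule has_derivative_vec_lambda)
    show "((\<lambda>x. if j \<in> J then R (idx j) x else (\<Sum>k\<in>UNIV. \<sigma> j $ k * x $ k)) has_derivative
        (\<lambda>h. \<Sum>k\<in>UNIV. \<sigma> j $ k * h $ k)) (at x0)" for j
      using der[of "idx j"] idx[of j] lin[of j] by (cases "j \<in> J") auto
  qed
  have V_eq: "(\<lambda>h. \<chi> j. \<Sum>k\<in>UNIV. \<sigma> j $ k * h $ k) = (\<lambda>h. V *v h)"
    by (simp add: V_def matrix_vector_mult_def)
  have "\<Psi> x0 \<in> interior (\<Psi> ` S)"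
  proof (rule sussmann_open_mapping[OF S(1) _ S(2) d\<Psi>[unfolded V_eq]])
    show "continuous_on S \<Psi>"
      unfolding \<Psi>_def
    proof (rule continuous_on_vec_lambda)
      show "continuous_on S (\<lambda>x. if j \<in> J then R (idx j) x else (\<Sum>k\<in>UNIV. \<sigma> j $ k * x $ k))" for j
        using cont[of "idx j"] idx[of j] by (cases "j \<in> J") (auto intro!: continuous_intros)
    qed
    show "bounded_linear (\<lambda>h. V' *v h)" by simp
    show "(\<lambda>h. V *v h) \<circ> (\<lambda>h. V' *v h) = id"
      by (simp add: fun_eq_iff matrix_vector_mul_assoc V')
    show "S \<subseteq> S" "x0 \<in> interior S" using S by (auto simp: interior_open)
  qed
  then obtain e where e: "0 < e" "ball (\<Psi> x0) e \<subseteq> \<Psi> ` S"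
    unfolding mem_interior by blast
  define s where "s = e / (2 * real CARD('n))"
  show thesis
  proof
    show "0 < s" using e by (simp add: s_def)
    fix z assume z: "\<And>i. i < m \<Longrightarrow> norm (z i - R i x0) \<le> s"
    define y where "y = (\<chi> j. if j \<in> J then z (idx j) else \<Psi> x0 $ j)"
    have "norm (y - \<Psi> x0) \<le> (\<Sum>j\<in>(UNIV::'n set). s)"
      by (rule order_trans[OF norm_le_sum_components sum_mono])
        (use z idx \<open>0 < s\<close> in \<open>auto simp: y_def \<Psi>_def\<close>)
    also have "\<dots> < e" using e by (simp add: s_def)
    finally have "y \<in> ball (\<Psi> x0) e" by (simp add: dist_norm norm_minus_commute)
    then obtain x where x: "x \<in> S" "\<Psi> x = y" using e by (metis imageE subsetD)
    have "R i x = z i" if "i < m" for i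
    proof -
      have "\<gamma> i \<in> Bs" using Bs(1) that by auto
      then obtain j where j: "\<sigma> j = \<gamma> i" using ran\<sigma> by (metis imageE)
      then have jJ: "j \<in> J" using that by (auto simp: J_def)
      then have "idx j = i" using idx[OF jJ] j inj that by (metis inj_onD lessThan_iff)
      moreover have "\<Psi> x $ j = y $ j" using x by simp
      ultimately show ?thesis using jJ by (simp add: \<Psi>_def y_def)
    qed
    then show "\<exists>x\<in>S. \<forall>i<m. R i x = z i" using x by blast
  qed
qed

section \<open>Order of vanishing of polynomials in first integrals\<close>

text \<open>The numerator of \<open>\<Prod>\<^sub>i (G\<^sub>i / H\<^sub>i)\<^bsup>a i\<^esup>\<close> over the common denominator \<open>\<Prod>\<^sub>i H\<^sub>i\<^sup>N\<close>.\<close>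

definition homogenized_monomial ::
  "nat \<Rightarrow> (nat \<Rightarrow> complex ^ 'n \<Rightarrow> complex) \<Rightarrow> (nat \<Rightarrow> complex ^ 'n \<Rightarrow> complex) \<Rightarrow>
    nat \<Rightarrow> (nat \<Rightarrow> nat) \<Rightarrow> complex ^ 'n \<Rightarrow> complex"
  where "homogenized_monomial m G H N a x = (\<Prod>i<m. G i x ^ a i * H i x ^ (N - a i))"

lemma pseries_homogenized_monomial:
  assumes r: "0 < r" and G: "\<And>i. i < m \<Longrightarrow> \<exists>b. pseries r L b (G i)"
    and H: "\<And>i. i < m \<Longrightarrow> \<exists>b. pseries r L b (H i)" and a: "\<And>i. i < m \<Longrightarrow> a i \<le> N"
  shows "\<exists>d. pseries r (L ^ (m * N)) d (homogenized_monomial m G H N a)"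
proof -
  have "\<exists>d. pseries r (L ^ N) d (\<lambda>x. G i x ^ a i * H i x ^ (N - a i))" if i: "i < m" for i
  proof -
    obtain b c where "pseries r L b (G i)" "pseries r L c (H i)" using G[OF i] H[OF i] by blast
    then obtain b' c' where "pseries r (L ^ a i) b' (\<lambda>x. G i x ^ a i)"
      "pseries r (L ^ (N - a i)) c' (\<lambda>x. H i x ^ (N - a i))"
      using pseries_power[OF r] by metis
    from pseries_mult[OF r this] show ?thesis
      using a[OF i] by (simp flip: power_add)
  qed
  then have "\<exists>d. pseries r (\<Prod>i<m. L ^ N) d (\<lambda>x. \<Prod>i<m. G i x ^ a i * H i x ^ (N - a i))"
    by (intro pseries_prod[OF r]) auto
  then show ?thesis
    by (simp add: homogenized_monomial_def[abs_def] power_mult[symmetric] mult.commute)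
qed

text \<open>Let \<open>\<kappa>\<close> be the largest modulus of a coefficient \<open>c a\<close> and \<open>P\<close> the combination of the monomials with these
coefficients. At points of \<open>S\<close> with \<open>G\<^sub>i = z\<^sub>i H\<^sub>i\<close> the quotient \<open>P / \<Prod>\<^sub>i H\<^sub>i\<^sup>N\<close> is the polynomial with
coefficients \<open>c a\<close> at \<open>z\<close>, and \<open>z\<close> ranges over the whole torus; hence \<open>\<kappa>\<close> is at most the supremum of this
quotient on \<open>S\<close>. If \<open>P\<close> vanishes to order greater than \<open>C N\<close>, the tail bound on half the polydisc makes this supremum at
most \<open>\<kappa> / 2\<close>.\<close>

lemma zero_estimate:
  fixes G H :: "nat \<Rightarrow> complex ^ 'n \<Rightarrow> complex"
  assumes r: "0 < r" and L: "0 < L" and q: "0 < q" and S: "S \<subseteq> polydisc (r / 2)"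
    and Hq: "\<And>x i. x \<in> S \<Longrightarrow> i < m \<Longrightarrow> q \<le> norm (H i x)"
    and surj: "\<And>z. (\<And>i. norm (z i) = 1) \<Longrightarrow> \<exists>x\<in>S. \<forall>i<m. G i x = z i * H i x"
    and C: "(2 * L / q) ^ m \<le> 2 ^ C"
    and N: "1 \<le> N"
    and d: "\<And>a. a \<in> {..<m} \<rightarrow>\<^sub>E {..N} \<Longrightarrow> pseries r (L ^ (m * N)) (d a) (homogenized_monomial m G H N a)"
    and vanish: "\<And>\<alpha>. sum \<alpha> UNIV \<le> C * N \<Longrightarrow> (\<Sum>a\<in>{..<m} \<rightarrow>\<^sub>E {..N}. c a * d a \<alpha>) = 0"
    and a: "a \<in> {..<m} \<rightarrow>\<^sub>E {..N}"
  shows "c a = 0"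
proof -
  define A where "A = {..<m} \<rightarrow>\<^sub>E {..N}"
  have fin: "finite A" by (simp add: A_def finite_PiE)
  have cardA: "card A = (N + 1) ^ m" by (simp add: A_def card_PiE)
  have ne: "A \<noteq> {}" using a by (auto simp: A_def)
  define \<kappa> where "\<kappa> = Max ((\<lambda>a. norm (c a)) ` A)"
  have le\<kappa>: "norm (c b) \<le> \<kappa>" if "b \<in> A" for b
    using fin that by (auto simp: \<kappa>_def)
  have "\<kappa> \<in> (\<lambda>a. norm (c a)) ` A"
    unfolding \<kappa>_def using fin ne by (intro Max_in) auto
  then obtain b where b: "b \<in> A" "\<kappa> = norm (c b)" by auto
  have \<kappa>0: "0 \<le> \<kappa>" using b by simp
  define P where "P x = (\<Sum>a\<in>A. c a * homogenized_monomial m G H N a x)" for x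
  have P: "pseries r (\<Sum>a\<in>A. norm (c a) * L ^ (m * N)) (\<lambda>\<alpha>. \<Sum>a\<in>A. c a * d a \<alpha>) P"
    unfolding P_def by (intro pseries_finite_sum[OF r fin] pseries_cmult d) (simp add: A_def)
  \<comment> \<open>There are \<open>(N+1)\<^sup>m \<le> 2\<^bsup>m N\<^esup>\<close> monomials, each of norm at most \<open>L\<^bsup>m N\<^esup>\<close>.\<close>
  define K where "K = (1 / 2 :: real) ^ (C * N + 1) * (\<kappa> * (2 * L) ^ (m * N))"
  have PK: "norm (P x) \<le> K" if x: "x \<in> S" for x
  proof -
    have "norm (P x) \<le> (1 / 2) ^ (C * N + 1) * (\<Sum>a\<in>A. norm (c a) * L ^ (m * N))"
    proof (rule pseries_tail_bound[OF P, where w = "\<lambda>_. 1"])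
      show "norm (x $ i) \<le> (1 / 2) ^ 1 * r" for i
        using S x by (auto simp: polydisc_def)
      show "C * N + 1 \<le> (\<Sum>i\<in>UNIV. 1 * \<alpha> i)" if "(\<Sum>a\<in>A. c a * d a \<alpha>) \<noteq> 0" for \<alpha>
        using vanish[of \<alpha>] that unfolding A_def by (cases "sum \<alpha> UNIV \<le> C * N") auto
    qed (use r in auto)
    also have "(\<Sum>a\<in>A. norm (c a) * L ^ (m * N)) \<le> (\<Sum>a\<in>A. \<kappa> * L ^ (m * N))"
      using le\<kappa> L by (intro sum_mono mult_right_mono) auto
    also have "\<dots> = real (N + 1) ^ m * (\<kappa> * L ^ (m * N))"
      by (simp add: cardA)
    also have "\<dots> \<le> (2 ^ N) ^ m * (\<kappa> * L ^ (m * N))"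
    proof (intro mult_right_mono power_mono)
      have "N + 1 \<le> 2 ^ N" using Suc_leI[OF less_exp[of N]] by simp
      then show "real (N + 1) \<le> 2 ^ N"
        by (metis of_nat_le_iff of_nat_numeral of_nat_power)
    qed (use L \<kappa>0 in auto)
    also have "\<dots> = \<kappa> * (2 * L) ^ (m * N)"
      by (simp add: power_mult_distrib power_mult[symmetric] mult_ac)
    finally show ?thesis by (simp add: K_def)
  qed
  have "norm (c b) \<le> K / q ^ (m * N)"
  proof (rule polynomial_coefficient_bound[where I = "{..<m}" and c = c and N = N])
    show "b \<in> {..<m} \<rightarrow>\<^sub>E {..N}" using b by (simp add: A_def)
    fix z :: "nat \<Rightarrow> complex" assume "\<And>i. norm (z i) = 1"
    then obtain x where x: "x \<in> S" "\<forall>i<m. G i x = z i * H i x" using surj by blast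
    have "homogenized_monomial m G H N a x = (\<Prod>i<m. z i ^ a i) * (\<Prod>i<m. H i x ^ N)" if "a \<in> A" for a
    proof -
      have "G i x ^ a i * H i x ^ (N - a i) = z i ^ a i * H i x ^ N" if "i < m" for i
      proof -
        have "a i \<le> N" using \<open>a \<in> A\<close> that by (auto simp: A_def)
        then have "H i x ^ N = H i x ^ a i * H i x ^ (N - a i)"
          by (simp flip: power_add)
        then show ?thesis using x that by (simp add: power_mult_distrib)
      qed
      then show ?thesis
        unfolding homogenized_monomial_def prod.distrib[symmetric] by (intro prod.cong) auto
    qed
    then have "P x = (\<Sum>a\<in>A. c a * (\<Prod>i<m. z i ^ a i)) * (\<Prod>i<m. H i x ^ N)"
      by (simp add: P_def sum_distrib_right mult.assoc)
    then have eq: "norm (P x) = norm (\<Sum>a\<in>A. c a * (\<Prod>i<m. z i ^ a i)) * norm (\<Prod>i<m. H i x ^ N)"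
      by (simp add: norm_mult)
    have "(\<Prod>i<m. q ^ N) \<le> (\<Prod>i<m. norm (H i x) ^ N)"
      using Hq[OF x(1)] q by (intro prod_mono conjI power_mono) auto
    then have "q ^ (m * N) \<le> norm (\<Prod>i<m. H i x ^ N)"
      by (simp add: norm_power power_mult[symmetric] mult.commute flip: prod_norm)
    then have "norm (\<Sum>a\<in>A. c a * (\<Prod>i<m. z i ^ a i)) * q ^ (m * N) \<le> norm (P x)"
      unfolding eq by (intro mult_left_mono) auto
    then have "norm (\<Sum>a\<in>A. c a * (\<Prod>i<m. z i ^ a i)) * q ^ (m * N) \<le> K"
      using PK[OF x(1)] by simp
    then show "norm (\<Sum>b\<in>{..<m} \<rightarrow>\<^sub>E {..N}. c b * (\<Prod>i<m. z i ^ b i)) \<le> K / q ^ (m * N)"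
      using q by (simp add: A_def field_simps)
  qed auto
  also have "K / q ^ (m * N) = (1 / 2) ^ (C * N + 1) * \<kappa> * ((2 * L / q) ^ m) ^ N"
  proof -
    have "(2 * L) ^ (m * N) / q ^ (m * N) = ((2 * L / q) ^ m) ^ N"
      by (simp only: power_mult power_divide)
    note ratio = this[symmetric]
    show ?thesis unfolding K_def ratio by simp
  qed
  also have "\<dots> \<le> (1 / 2) ^ (C * N + 1) * \<kappa> * (2 ^ C) ^ N"
    using C L q \<kappa>0 by (intro mult_left_mono power_mono) auto
  also have "\<dots> = \<kappa> / 2"
    by (simp add: power_mult[symmetric] power_divide)
  finally have "\<kappa> = 0" using b \<kappa>0 by simp
  then show ?thesis using le\<kappa>[of a] a by (simp add: A_def)
qed

text \<open>The points of the dense set where the gradients are independent come arbitrarily close to the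
origin, in particular into half of the polydisc on which all expansions at the origin converge. Near such
a point \<open>x0\<close> the values of \<open>(G\<^sub>i / H\<^sub>i)\<^sub>i\<close> cover a polydisc with centre \<open>\<rho>\<close> and radius \<open>s\<close>. Replacing \<open>G\<^sub>i\<close> by
\<open>(G\<^sub>i - \<rho>\<^sub>i H\<^sub>i) / s\<close>, the numerator of another first integral, turns it into the unit polydisc. The matrices express
everything in the coordinates in which the linear part is triangular.\<close>

lemma normalized_first_integrals:
  fixes G H :: "nat \<Rightarrow> complex ^ 'n \<Rightarrow> complex" and P Q :: "complex ^ 'n ^ 'n"
  assumes W: "open W" "0 \<in> W"
    and an: "\<And>i. i < m \<Longrightarrow> mv_analytic_on (G i) W" "\<And>i. i < m \<Longrightarrow> mv_analytic_on (H i) W"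
    and ind: "functionally_independent W m G H"
    and PQ: "P ** Q = mat 1"
  obtains r L q s :: real and S :: "(complex ^ 'n) set" and \<rho> :: "nat \<Rightarrow> complex"
  where "0 < r" "0 < L" "0 < q" "0 < s" "S \<subseteq> polydisc (r / 2)"
    "\<And>i. i < m \<Longrightarrow> \<exists>b. pseries r L b (\<lambda>z. (G i (P *v z) - \<rho> i * H i (P *v z)) / of_real s)"
    "\<And>i. i < m \<Longrightarrow> \<exists>b. pseries r L b (\<lambda>z. H i (P *v z))"
    "\<And>x i. x \<in> S \<Longrightarrow> i < m \<Longrightarrow> q \<le> norm (H i (P *v x))"
    "\<And>z. (\<And>i. norm (z i) = 1) \<Longrightarrow>
      \<exists>x\<in>S. \<forall>i<m. (G i (P *v x) - \<rho> i * H i (P *v x)) / of_real s = z i * H i (P *v x)"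
proof -
  have germ: "\<exists>r>0. \<exists>M b. pseries r M b (\<lambda>z. g (P *v z))" if g: "mv_analytic_on g W" for g
  proof -
    obtain r M b where "0 < r" "pseries r M b g"
      using analytic_imp_pseries[OF g W(2)] by auto
    from pseries_linear_substitution[OF this(2,1)] show ?thesis by blast
  qed
  obtain r1 where r1: "0 < r1" "\<forall>i<m. \<exists>M b. pseries r1 M b (\<lambda>z. G i (P *v z))"
    using pseries_common_radius[of m "\<lambda>i z. G i (P *v z)"] germ an(1) by blast
  obtain r2 where r2: "0 < r2" "\<forall>i<m. \<exists>M b. pseries r2 M b (\<lambda>z. H i (P *v z))"
    using pseries_common_radius[of m "\<lambda>i z. H i (P *v z)"] germ an(2) by blast
  define r where "r = min r1 r2"
  have r: "0 < r" using r1 r2 by (simp add: r_def)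
  have rG: "\<exists>M b. pseries r M b (\<lambda>z. G i (P *v z))" if "i < m" for i
    using r1(2)[rule_format, OF that] pseries_shrink[of r1] r by (metis min.cobounded1 less_imp_le r_def)
  have rH: "\<exists>M b. pseries r M b (\<lambda>z. H i (P *v z))" if "i < m" for i
    using r2(2)[rule_format, OF that] pseries_shrink[of r2] r by (metis min.cobounded2 less_imp_le r_def)
  obtain D where D: "open D" "D \<subseteq> W" "W \<subseteq> closure D" and Dx: "\<And>x. x \<in> D \<Longrightarrow> (\<forall>i<m. H i x \<noteq> 0) \<and>
      inj_on (\<lambda>i. cgradient (\<lambda>y. G i y / H i y) x) {..<m} \<and>
      vec.independent ((\<lambda>i. cgradient (\<lambda>y. G i y / H i y) x) ` {..<m})"
    using ind unfolding functionally_independent_def by blast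
  define V where "V = (\<Inter>i. {x. norm ((Q *v x) $ i) < r / 2})"
  have "open {x. norm ((Q *v x) $ i) < r / 2}" for i
    by (intro open_Collect_less continuous_intros linear_continuous_on) simp
  then have V: "open V" unfolding V_def by (intro open_INT) auto
  moreover have "0 \<in> V" using r by (simp add: V_def)
  moreover have "0 \<in> closure D" using W D by blast
  ultimately obtain x0 where x0: "x0 \<in> D" "x0 \<in> V"
    using open_Int_closure_eq_empty[of V D] by blast
  define q where "q = Min (insert 1 ((\<lambda>i. norm (H i x0) / 2) ` {..<m}))"
  have q: "0 < q" using Dx[OF x0(1)] by (simp add: q_def)
  have qH: "q < norm (H i x0)" if "i < m" for i
  proof -
    have "q \<le> norm (H i x0) / 2" unfolding q_def using that by (intro Min_le) auto
    also have "\<dots> < norm (H i x0)" using Dx[OF x0(1)] that by simp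
    finally show ?thesis .
  qed
  define S where "S = D \<inter> V \<inter> (\<Inter>i\<in>{..<m}. D \<inter> H i -` {y. q < norm y})"
  have contD: "continuous_on D (G i)" "continuous_on D (H i)" if "i < m" for i
    using analytic_continuous_on an that D(2) continuous_on_subset by blast+
  have "open (D \<inter> H i -` {y. q < norm y})" if "i < m" for i
    by (intro continuous_open_preimage contD(2) that D open_Collect_less continuous_intros)
  then have S: "open S" unfolding S_def by (intro open_Int D V open_INT) auto
  have x0S: "x0 \<in> S" using x0 qH by (auto simp: S_def)
  have SH: "q < norm (H i x)" if "x \<in> S" "i < m" for x i
    using that unfolding S_def by blast
  define \<rho> where "\<rho> i = G i x0 / H i x0" for i
  define \<gamma> where "\<gamma> i = cgradient (\<lambda>y. G i y / H i y) x0" for i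
  have "inj_on \<gamma> {..<m}" "vec.independent (\<gamma> ` {..<m})"
    using Dx[OF x0(1)] by (auto simp: \<gamma>_def[abs_def])
  moreover have "continuous_on S (\<lambda>x. G i x / H i x)" if "i < m" for i
  proof -
    have "S \<subseteq> D" by (auto simp: S_def)
    then show ?thesis
      using contD[OF that] continuous_on_subset SH that q
      by (intro continuous_on_divide) (blast, blast, fastforce)
  qed
  moreover have "((\<lambda>x. G i x / H i x) has_derivative (\<lambda>h. \<Sum>j\<in>UNIV. \<gamma> i $ j * h $ j)) (at x0)" if "i < m" for i
    unfolding \<gamma>_def using analytic_quotient_gradient[OF an(1,2)[OF that], of x0] Dx x0 D that by blast
  ultimately obtain s where s: "0 < s" "\<And>z. (\<And>i. i < m \<Longrightarrow> norm (z i - G i x0 / H i x0) \<le> s) \<Longrightarrow>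
      \<exists>x\<in>S. \<forall>i<m. G i x / H i x = z i"
    using independent_gradients_image[OF S x0S, of m "\<lambda>i x. G i x / H i x" \<gamma>] by blast
  have "\<exists>M b. pseries r M b (\<lambda>z. (G i (P *v z) - \<rho> i * H i (P *v z)) / of_real s)" if i: "i < m" for i
  proof -
    obtain M b M' b' where "pseries r M b (\<lambda>z. G i (P *v z))" "pseries r M' b' (\<lambda>z. H i (P *v z))"
      using rG[OF i] rH[OF i] by blast
    then have "pseries r
        (\<Sum>k\<in>{True, False}. if k then norm (1 / complex_of_real s) * M else norm (- \<rho> i / of_real s) * M')
        (\<lambda>\<alpha>. \<Sum>k\<in>{True, False}.
          (if k then (\<lambda>\<alpha>. 1 / of_real s * b \<alpha>) else (\<lambda>\<alpha>. - \<rho> i / of_real s * b' \<alpha>)) \<alpha>)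
        (\<lambda>z. \<Sum>k\<in>{True, False}.
          (if k then (\<lambda>z. 1 / of_real s * G i (P *v z)) else (\<lambda>z. - \<rho> i / of_real s * H i (P *v z))) z)"
      using pseries_cmult[of r _ _ _ "1 / complex_of_real s"]
        pseries_cmult[of r _ _ _ "- \<rho> i / complex_of_real s"]
      by (intro pseries_finite_sum[OF r]) auto
    then show ?thesis by (auto simp: diff_divide_distrib)
  qed
  then obtain L1 where L1: "0 < L1" "\<forall>L'\<ge>L1. \<forall>i<m. \<exists>b. pseries r L' b (\<lambda>z. (G i (P *v z) - \<rho> i * H i (P *v z)) / of_real s)"
    using pseries_common_bound[of m r "\<lambda>i z. (G i (P *v z) - \<rho> i * H i (P *v z)) / of_real s"] by blast
  obtain L2 where L2: "0 < L2" "\<forall>L'\<ge>L2. \<forall>i<m. \<exists>b. pseries r L' b (\<lambda>z. H i (P *v z))"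
    using pseries_common_bound[of m r "\<lambda>i z. H i (P *v z)"] rH by blast
  have PQx: "P *v (Q *v x) = x" for x by (simp add: matrix_vector_mul_assoc PQ)
  show thesis
  proof (rule that[of r "max L1 L2" q s "(\<lambda>x. Q *v x) ` S" \<rho>])
    show "(\<lambda>x. Q *v x) ` S \<subseteq> polydisc (r / 2)"
      by (auto simp: S_def V_def polydisc_def less_imp_le)
    show "q \<le> norm (H i (P *v x))" if "x \<in> (\<lambda>x. Q *v x) ` S" "i < m" for x i
      using that by (auto simp: PQx intro: less_imp_le[OF SH])
    show "\<exists>x\<in>(\<lambda>x. Q *v x) ` S. \<forall>i<m. (G i (P *v x) - \<rho> i * H i (P *v x)) / of_real s = z i * H i (P *v x)"
      if z: "\<And>i. norm (z i) = 1" for z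
    proof -
      have "norm (\<rho> i + of_real s * z i - G i x0 / H i x0) \<le> s" for i
        using z s(1) by (simp add: \<rho>_def norm_mult)
      then obtain x where x: "x \<in> S" "\<forall>i<m. G i x / H i x = \<rho> i + of_real s * z i"
        using s(2)[of "\<lambda>i. \<rho> i + of_real s * z i"] by blast
      have "(G i x - \<rho> i * H i x) / of_real s = z i * H i x" if "i < m" for i
      proof -
        have "H i x \<noteq> 0" using SH[OF x(1) that] q by auto
        moreover have "G i x / H i x = \<rho> i + of_real s * z i" using x that by blast
        ultimately have "G i x = (\<rho> i + of_real s * z i) * H i x" by (simp add: field_simps)
        then show ?thesis using s(1) by (simp add: algebra_simps)
      qed
      then show ?thesis using x(1) by (intro bexI[of _ "Q *v x"]) (auto simp: PQx)
    qed
  qed (use r L1 L2 q s in auto)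
qed

section \<open>Counting leading exponents\<close>

text \<open>Each \<open>b i\<close> is \<open>0\<close>, so the monomial of \<open>b\<close> is the common denominator \<open>\<Prod>\<^sub>i H\<^sub>i\<^sup>N\<close>, and quotients by it are
invariant factor by factor.\<close>

lemma homogenized_monomial_invariant:
  assumes inv: "\<And>i. i < m \<Longrightarrow> G i y * H i x = G i x * H i y"
    and a: "\<And>i. i < m \<Longrightarrow> a i \<le> N" and b: "\<And>i. i < m \<Longrightarrow> b i = 0"
  shows "homogenized_monomial m G H N a y * homogenized_monomial m G H N b x = homogenized_monomial m G H N a x * homogenized_monomial m G H N b y"
proof -
  have "G i y ^ a i * H i y ^ (N - a i) * (G i x ^ b i * H i x ^ (N - b i))
      = G i x ^ a i * H i x ^ (N - a i) * (G i y ^ b i * H i y ^ (N - b i))" if i: "i < m" for i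
  proof -
    have split: "z ^ N = z ^ a i * z ^ (N - a i)" for z :: complex
      using a[OF i] by (simp flip: power_add)
    have "(G i y * H i x) ^ a i * (H i y * H i x) ^ (N - a i)
        = (G i x * H i y) ^ a i * (H i y * H i x) ^ (N - a i)"
      by (simp add: inv[OF i])
    then show ?thesis
      by (simp add: b[OF i] split power_mult_distrib mult_ac)
  qed
  then show ?thesis
    unfolding homogenized_monomial_def prod.distrib[symmetric] by (intro prod.cong) auto
qed

theorem theorem1:
  fixes f :: "complex ^ 'n \<Rightarrow> complex ^ 'n"
    and \<mu> :: "complex ^ 'n"
    and U W :: "(complex ^ 'n) set"
    and m :: nat
    and G H :: "nat \<Rightarrow> complex ^ 'n \<Rightarrow> complex"
  assumes "local_analytic_diffeo f U"
    and "eigenvalues_with_mult (jacobian f (at 0)) \<mu>"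
    and "open W" and "connected W" and "0 \<in> W" and "W \<subseteq> U"
    and "\<And>i. i < m \<Longrightarrow> meromorphic_first_integral f W (G i) (H i)"
    and "functionally_independent W m G H"
  shows "m \<le> int_span_rank {k :: int ^ 'n. mv_powi \<mu> k = 1}"
proof (rule ccontr)
  assume contra: "\<not> ?thesis"
  have \<mu>0: "\<mu> $ i \<noteq> 0" for i
    using assms(1,2) eigenvalues_nonzero by (auto simp: local_analytic_diffeo_def)
  obtain P Q :: "complex ^ 'n ^ 'n" and ord :: "'n \<Rightarrow> nat"
    where ord: "bij_betw ord UNIV {..<CARD('n)}" and PQ: "P ** Q = mat 1"
      and tri: "\<And>i j. ord j < ord i \<Longrightarrow> (Q ** jacobian f (at 0) ** P) $ i $ j = 0"
      and diag: "\<And>i. (Q ** jacobian f (at 0) ** P) $ i $ i = \<mu> $ i"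
    using triangularization[OF assms(2)] by metis
  have PQx: "P *v (Q *v x) = x" for x by (simp add: matrix_vector_mul_assoc PQ)
  obtain I :: "'n set" where I: "card I \<le> int_span_rank {k :: int ^ 'n. mv_powi \<mu> k = 1}"
    "\<And>k. mv_powi \<mu> k = 1 \<Longrightarrow> (\<And>i. i \<in> I \<Longrightarrow> k $ i = 0) \<Longrightarrow> k = 0"
    using determining_coordinates[of "{k :: int ^ 'n. mv_powi \<mu> k = 1}"] by auto
  have Im: "card I < m" using I(1) contra by linarith
  have an: "mv_analytic_on (G i) W" "mv_analytic_on (H i) W"
    and inv: "\<And>x. x \<in> W \<Longrightarrow> f x \<in> W \<Longrightarrow> G i (f x) * H i x = G i x * H i (f x)" if "i < m" for i
    using assms(7)[OF that] by (auto simp: meromorphic_first_integral_def)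
  show False
  proof (rule normalized_first_integrals[OF assms(3,5) an assms(8) PQ])
    fix r L q s :: real and S :: "(complex ^ 'n) set" and \<rho> :: "nat \<Rightarrow> complex"
    assume r: "0 < r" and L: "0 < L" and q: "0 < q" and s: "0 < s"
      and S: "S \<subseteq> polydisc (r / 2)"
      and Gs: "\<And>i. i < m \<Longrightarrow> \<exists>b. pseries r L b (\<lambda>z. (G i (P *v z) - \<rho> i * H i (P *v z)) / of_real s)"
      and Hs: "\<And>i. i < m \<Longrightarrow> \<exists>b. pseries r L b (\<lambda>z. H i (P *v z))"
      and Hq: "\<And>x i. x \<in> S \<Longrightarrow> i < m \<Longrightarrow> q \<le> norm (H i (P *v x))"
      and surj: "\<And>z. (\<And>i. norm (z i) = 1) \<Longrightarrow>
        \<exists>x\<in>S. \<forall>i<m. (G i (P *v x) - \<rho> i * H i (P *v x)) / of_real s = z i * H i (P *v x)"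
    define G' where "G' i z = (G i (P *v z) - \<rho> i * H i (P *v z)) / of_real s" for i z
    define H' where "H' i z = H i (P *v z)" for i z
    define f' where "f' z = Q *v f (P *v z)" for z
    obtain C where "(2 * L / q) ^ m < 2 ^ C"
      using real_arch_pow[of 2 "(2 * L / q) ^ m"] by auto
    then have C: "(2 * L / q) ^ m \<le> 2 ^ C" by simp
    \<comment> \<open>Chosen so that \<open>(C N + 1)\<^bsup>card I\<^esup> \<le> (C + 1)\<^bsup>card I\<^esup> (N + 1)\<^bsup>card I\<^esup> < (N + 1)\<^bsup>card I + 1\<^esup>\<close>.\<close>
    define N where "N = (C + 1) ^ card I"
    define M where "M = C * N"
    \<comment> \<open>The base must exceed the degrees \<open>M\<close> to be separated, and be at least 2 for the map.\<close>
    define w where "w = lex_weight (M + 2) ord"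
    define A where "A = {..<m} \<rightarrow>\<^sub>E {..N}"
    have N: "1 \<le> N" by (simp add: N_def)
    have w1: "1 \<le> w i" for i by (simp add: w_def lex_weight_def Suc_le_eq)
    have "\<exists>d. pseries r (L ^ (m * N)) d (homogenized_monomial m G' H' N a)" if "a \<in> A" for a
      using that by (intro pseries_homogenized_monomial[OF r]) (auto simp: A_def G'_def[abs_def] H'_def[abs_def] Gs Hs)
    then obtain d where d: "\<And>a. a \<in> A \<Longrightarrow> pseries r (L ^ (m * N)) (d a) (homogenized_monomial m G' H' N a)"
      by metis
    have estimate: "\<exists>\<alpha>. sum \<alpha> UNIV \<le> M \<and> (\<Sum>a\<in>A. c a * d a \<alpha>) \<noteq> 0" if "a \<in> A" "c a \<noteq> 0" for a and c
    proof (rule ccontr)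
      assume none: "\<not> ?thesis"
      have "c a = 0"
        by (rule zero_estimate[OF r L q S, of m H' G' C N d c a])
          (use C N Hq surj d none that in \<open>auto simp: A_def G'_def H'_def M_def\<close>)
      then show False using that by simp
    qed
    have evinv: "\<forall>\<^sub>F z in nhds 0. \<forall>i<m. G' i (f' z) * H' i z = G' i z * H' i (f' z)"
    proof -
      have f0: "f 0 = 0" using assms(1) by (simp add: local_analytic_diffeo_def)
      have "continuous (at 0) f"
        using analytic_diffeo_derivative[OF assms(1)] has_derivative_continuous by blast
      then have "(f \<longlongrightarrow> f 0) (nhds 0)"
        using isCont_def tendsto_at_iff_tendsto_nhds by blast
      then have "(f \<longlongrightarrow> 0) (nhds 0)" using f0 by simp
      then have evf: "\<forall>\<^sub>F x in nhds 0. f x \<in> W"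
        using assms(3,5) topological_tendstoD by blast
      have evW: "\<forall>\<^sub>F x in nhds 0. x \<in> W"
        using assms(3,5) eventually_nhds_in_open by blast
      have lim: "filterlim (\<lambda>z. P *v z) (nhds 0) (nhds 0)"
      proof -
        have "isCont (\<lambda>z. P *v z) 0" by (rule linear_continuous_at) simp
        then have "filterlim (\<lambda>z. P *v z) (nhds (P *v 0)) (nhds 0)"
          using isCont_def tendsto_at_iff_tendsto_nhds by blast
        then show ?thesis by simp
      qed
      have "\<forall>\<^sub>F z in nhds 0. P *v z \<in> W \<and> f (P *v z) \<in> W"
        using eventually_compose_filterlim[OF eventually_conj[OF evW evf] lim] .
      then show ?thesis
      proof eventually_elim
        case (elim z)
        show ?case
        proof (intro allI impI)
          fix i assume "i < m"
          then show "G' i (f' z) * H' i z = G' i z * H' i (f' z)"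
            using inv[of i "P *v z"] elim
            by (simp add: G'_def H'_def f'_def PQx algebra_simps diff_divide_distrib)
        qed
      qed
    qed
    have f'lim: "((\<lambda>t. f' (\<chi> k. of_real t ^ w k) $ i / of_real t ^ w i) \<longlongrightarrow> \<mu> $ i) (at_right 0)" for i
      unfolding f'_def w_def by (rule conjugated_diffeo_leading_term[OF assms(1) ord _ tri diag]) auto
    \<comment> \<open>the exponent of the common denominator \<open>\<Prod>\<^sub>i H\<^sub>i\<^sup>N\<close>\<close>
    define a0 where "a0 = restrict (\<lambda>_. 0 :: nat) {..<m}"
    have a0: "a0 \<in> A" by (auto simp: a0_def A_def)
    have fin: "finite A" by (simp add: A_def finite_PiE)
    have "\<exists>\<beta>. sum \<beta> UNIV \<le> M \<and> d a0 \<beta> \<noteq> 0"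
      using estimate[OF a0, of "\<lambda>a. if a = a0 then 1 else 0"] fin a0
      by (simp add: if_distrib[of "\<lambda>z. z * _"] cong: if_cong)
    then obtain \<beta>0 where \<beta>0: "d a0 \<beta>0 \<noteq> 0" "sum \<beta>0 UNIV \<le> M" by blast
    have MB: "M < M + 2" by simp
    obtain \<beta> where \<beta>: "d a0 \<beta> \<noteq> 0" "\<And>\<gamma>. d a0 \<gamma> \<noteq> 0 \<Longrightarrow> \<gamma> \<noteq> \<beta> \<Longrightarrow>
        (\<Sum>i\<in>UNIV. w i * \<beta> i) < (\<Sum>i\<in>UNIV. w i * \<gamma> i)"
      using lowest_exponent[of ord M "M + 2" "d a0" \<beta>0, OF ord MB \<beta>0, folded w_def] by blast
    define E where "E = {\<alpha>. sum \<alpha> UNIV \<le> M \<and> mpow \<mu> \<alpha> = mpow \<mu> \<beta>}"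
    have finE: "finite E" and cardE: "card E \<le> (M + 1) ^ card I"
      using card_resonance_class_le[OF \<mu>0 I(2)] unfolding E_def by blast+
    have "card E < card A"
    proof -
      have "(M + 1) ^ card I \<le> ((C + 1) * (N + 1)) ^ card I"
        by (intro power_mono) (auto simp: M_def)
      also have "\<dots> = N * (N + 1) ^ card I"
        by (simp only: N_def power_mult_distrib)
      also have "\<dots> < (N + 1) * (N + 1) ^ card I" by simp
      also have "\<dots> \<le> (N + 1) ^ m"
        using Im power_increasing[of "Suc (card I)" m "N + 1"] by simp
      also have "\<dots> = card A" by (simp add: A_def card_PiE)
      finally show ?thesis using cardE by simp
    qed
    \<comment> \<open>A combination of the monomials whose coefficients at all exponents in \<open>E\<close> vanish. By the zero estimate
      its lowest exponent has degree at most \<open>M\<close>, and by invariance it lies in \<open>E\<close>: a contradiction.\<close>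
    from homogeneous_system_nontrivial_solution[OF finE fin this, of "\<lambda>\<alpha> a. d a \<alpha>"]
    obtain c a where ca: "a \<in> A" "c a \<noteq> 0" and c0: "\<And>\<alpha>. \<alpha> \<in> E \<Longrightarrow> (\<Sum>a\<in>A. c a * d a \<alpha>) = 0"
      by blast
    define p where "p \<alpha> = (\<Sum>a\<in>A. c a * d a \<alpha>)" for \<alpha>
    define R where "R z = (\<Sum>a\<in>A. c a * homogenized_monomial m G' H' N a z)" for z
    have R: "pseries r (\<Sum>a\<in>A. norm (c a) * L ^ (m * N)) p R"
      unfolding R_def[abs_def] p_def[abs_def] by (intro pseries_finite_sum[OF r fin] pseries_cmult d)
    obtain \<alpha>0 where \<alpha>0: "p \<alpha>0 \<noteq> 0" "sum \<alpha>0 UNIV \<le> M"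
      using estimate[of a c, OF ca] by (auto simp: p_def)
    obtain \<alpha> where \<alpha>: "p \<alpha> \<noteq> 0" "sum \<alpha> UNIV \<le> M" "\<And>\<gamma>. p \<gamma> \<noteq> 0 \<Longrightarrow> \<gamma> \<noteq> \<alpha> \<Longrightarrow>
        (\<Sum>i\<in>UNIV. w i * \<alpha> i) < (\<Sum>i\<in>UNIV. w i * \<gamma> i)"
      using lowest_exponent[of ord M "M + 2" p \<alpha>0, OF ord MB \<alpha>0, folded w_def] by blast
    have "\<forall>\<^sub>F z in nhds 0. R (f' z) * homogenized_monomial m G' H' N a0 z = R z * homogenized_monomial m G' H' N a0 (f' z)"
      using evinv
    proof eventually_elim
      case (elim z)
      have "homogenized_monomial m G' H' N a (f' z) * homogenized_monomial m G' H' N a0 z = homogenized_monomial m G' H' N a z * homogenized_monomial m G' H' N a0 (f' z)"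
        if "a \<in> A" for a
        by (rule homogenized_monomial_invariant) (use elim that in \<open>auto simp: A_def a0_def\<close>)
      then show ?case
        by (simp add: R_def sum_distrib_right mult.assoc)
    qed
    then have "mpow \<mu> \<alpha> = mpow \<mu> \<beta>"
      by (rule leading_exponents_resonant[OF R d[OF a0] r w1 f'lim _ \<alpha>(1,3) \<beta>])
    then have "\<alpha> \<in> E" using \<alpha>(2) by (simp add: E_def)
    then show False using c0 \<alpha>(1) by (simp add: p_def)
  qed
qed

end
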